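(* Let $(M_i)_{i\in I}$ be an indexed family of $\mathcal{L}$-structures, let $D$ be an ultrafilter on $I$, and let $\mathcal{M}:=\prod_D M_i$. Let $\mu\in\mathfrak{M}_x(\mathcal{M})$ and $\nu\in\mathfrak{M}_y(\mathcal{M})$. Suppose that both $\mu$ and $\nu$ are pseudo-finite. If $\mu$ and $\nu$ are both ($\mathcal{M}$-)definable, then $\mu\otimes\nu=\nu\otimes\mu$.
   Context: $\mathcal{L}$ is a first-order language; $I$ is an infinite index set; all ultrafilters are non-principal; letters $x,y$ denote finite tuples of variables. For an $\mathcal{L}$-structure $M$, $\mathcal{L}_x(M)$ is the collection of $\mathcal{L}$-formulas with parameters from $M$ and free variables $x$ (modulo equivalence in $M$), and $\mathfrak{M}_x(M)$ is the space of Keisler measures over $M$, i.e. finitely additive probability measures on $\mathcal{L}_x(M)$. For $p\in S_x(M)$, $\delta_p$ is the Dirac measure at $p$. Let $\mathrm{conv}_x(M)=\{\sum_{i=1}^n r_i\delta_{\mathrm{tp}(a_i/M)}: n\ge 1,\ a_i\in M^x,\ r_i>0,\ \sum_{i=1}^n r_i=1\}$. Elements of $\mathcal{M}=\prod_D M_i$ are written $\mathbf{b}$, with representative $(\mathbf{b}(i))_{i\in I}$. Given $\mu_i\in\mathfrak{M}_x(M_i)$, the ultralimit $\lim_D\mu_i\in\mathfrak{M}_x(\mathcal{M})$ is the measure with $(\lim_D\mu_i)(\varphi(x,\mathbf{b}))=\lim_D\mu_i(\varphi(x,\mathbf{b}(i)))$ for all $\varphi(x,\mathbf{b})\in\mathcal{L}_x(\mathcal{M})$.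 A measure $\mu\in\mathfrak{M}_x(\mathcal{M})$ is pseudo-finite if $\mu=\lim_D\mu_i$ for some $\mu_i\in\mathrm{conv}_x(M_i)$, $i\in I$. $\mu\in\mathfrak{M}_x(M)$ is $M$-definable (or definable) if for every $\mathcal{L}$-formula $\varphi(x,y)$ there is a (necessarily unique) continuous function $F^{\varphi}_{\mu,M}:S_y(M)\to[0,1]$ with $F^{\varphi}_{\mu,M}(\mathrm{tp}(b/M))=\mu(\varphi(x,b))$ for all $b\in M^y$. Morley product: if $\mu\in\mathfrak{M}_x(M)$ is $M$-definable and $\nu\in\mathfrak{M}_y(M)$, then $\mu\otimes\nu\in\mathfrak{M}_{xy}(M)$ is given by $(\mu\otimes\nu)(\varphi(x,y,c))=\int_{S_y(M)}F^{\varphi_c}_{\mu,M}\,d\tilde\nu$ for $\varphi(x,y,c)\in\mathcal{L}_{xy}(M)$, where $F^{\varphi_c}_{\mu,M}:S_y(M)\to[0,1]$ is the unique continuous map extending $\mathrm{tp}(b/M)\mapsto\mu(\varphi(x,b,c))$ and $\tilde\nu$ is the unique regular Borel probability measure on $S_y(M)$ with $\tilde\nu([\psi(y)])=\nu(\psi(y))$ for all $\psi(y)\in\mathcal{L}_y(M)$. When $\nu$ is definable, $\nu\otimes\mu\in\mathfrak{M}_{xy}(M)$ is defined in the same way with the roles of $x,\mu$ and $y,\nu$ exchanged (integrating, over $S_x(M)$ with respect to $\mu$, the map $\mathrm{tp}(a/M)\mapsto\nu(\varphi(a,y,c))$). *)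

theory Defs
  imports "HOL-Probability.Probability_Measure"
begin

text \<open>The symbols of a language are sets rather than whole types, so that a language may have
  no function symbols or no relation symbols.  Constants are function symbols of arity 0.\<close>

record ('f, 'r) lang =
  funs :: "'f set"
  farity :: "'f \<Rightarrow> nat"
  rels :: "'r set"
  rarity :: "'r \<Rightarrow> nat"

record ('f, 'r, 'a) struct =
  univ :: "'a set"
  finterp :: "'f \<Rightarrow> 'a list \<Rightarrow> 'a"
  rinterp :: "'r \<Rightarrow> 'a list \<Rightarrow> bool"

definition is_struct :: "('f, 'r) lang \<Rightarrow> ('f, 'r, 'a) struct \<Rightarrow> bool" where
  "is_struct L M \<longleftrightarrow> univ M \<noteq> {} \<and>
     (\<forall>f\<in>funs L. \<forall>as. length as = farity L f \<and> set as \<subseteq> univ M \<longrightarrow> finterp M f as \<in> univ M)"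

text \<open>\<open>Par a\<close> is the parameter \<open>a\<close>, used as a constant naming itself.  The functorial maps
  \<open>map_tm\<close> and \<open>map_fm\<close> act on parameters only.  An \<open>L\<close>-formula proper is one
  without parameters.\<close>

datatype (dead 'f, params_tm: 'p) tm =
  Var nat | Par 'p | Fn 'f "('f, 'p) tm list"

datatype (dead 'f, dead 'r, params: 'p) fm =
  Fls
| Eq "('f, 'p) tm" "('f, 'p) tm"
| Rel 'r "('f, 'p) tm list"
| Neg "('f, 'r, 'p) fm"
| Or "('f, 'r, 'p) fm" "('f, 'r, 'p) fm"
| Ex nat "('f, 'r, 'p) fm"

primrec fv_tm :: "('f, 'p) tm \<Rightarrow> nat set" where
  "fv_tm (Var v) = {v}"
| "fv_tm (Par a) = {}"
| "fv_tm (Fn f ts) = \<Union> (set (map fv_tm ts))"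

primrec fv :: "('f, 'r, 'p) fm \<Rightarrow> nat set" where
  "fv Fls = {}"
| "fv (Eq s t) = fv_tm s \<union> fv_tm t"
| "fv (Rel r ts) = \<Union> (fv_tm ` set ts)"
| "fv (Neg \<phi>) = fv \<phi>"
| "fv (Or \<phi> \<psi>) = fv \<phi> \<union> fv \<psi>"
| "fv (Ex v \<phi>) = fv \<phi> - {v}"

primrec wf_tm :: "('f, 'r) lang \<Rightarrow> ('f, 'p) tm \<Rightarrow> bool" where
  "wf_tm L (Var v) \<longleftrightarrow> True"
| "wf_tm L (Par a) \<longleftrightarrow> True"
| "wf_tm L (Fn f ts) \<longleftrightarrow> f \<in> funs L \<and> length ts = farity L f \<and> list_all id (map (wf_tm L) ts)"

primrec wf_fm :: "('f, 'r) lang \<Rightarrow> ('f, 'r, 'p) fm \<Rightarrow> bool" where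
  "wf_fm L Fls \<longleftrightarrow> True"
| "wf_fm L (Eq s t) \<longleftrightarrow> wf_tm L s \<and> wf_tm L t"
| "wf_fm L (Rel r ts) \<longleftrightarrow> r \<in> rels L \<and> length ts = rarity L r \<and> (\<forall>t\<in>set ts. wf_tm L t)"
| "wf_fm L (Neg \<phi>) \<longleftrightarrow> wf_fm L \<phi>"
| "wf_fm L (Or \<phi> \<psi>) \<longleftrightarrow> wf_fm L \<phi> \<and> wf_fm L \<psi>"
| "wf_fm L (Ex v \<phi>) \<longleftrightarrow> wf_fm L \<phi>"

primrec eval_tm :: "('f, 'r, 'a) struct \<Rightarrow> (nat \<Rightarrow> 'a) \<Rightarrow> ('f, 'a) tm \<Rightarrow> 'a" where
  "eval_tm M e (Var v) = e v"
| "eval_tm M e (Par a) = a"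
| "eval_tm M e (Fn f ts) = finterp M f (map (eval_tm M e) ts)"

primrec sat :: "('f, 'r, 'a) struct \<Rightarrow> (nat \<Rightarrow> 'a) \<Rightarrow> ('f, 'r, 'a) fm \<Rightarrow> bool" where
  "sat M e Fls \<longleftrightarrow> False"
| "sat M e (Eq s t) \<longleftrightarrow> eval_tm M e s = eval_tm M e t"
| "sat M e (Rel r ts) \<longleftrightarrow> rinterp M r (map (eval_tm M e) ts)"
| "sat M e (Neg \<phi>) \<longleftrightarrow> \<not> sat M e \<phi>"
| "sat M e (Or \<phi> \<psi>) \<longleftrightarrow> sat M e \<phi> \<or> sat M e \<psi>"
| "sat M e (Ex v \<phi>) \<longleftrightarrow> (\<exists>a\<in>univ M. sat M (e(v := a)) \<phi>)"

text \<open>\<open>inst Y b \<phi>\<close> substitutes the parameter \<open>b v\<close> for the free occurrences of each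
  variable \<open>v \<in> Y\<close>; it is \<open>\<phi>(x,b)\<close> when \<open>\<phi> = \<phi>(x,y)\<close>.\<close>

primrec inst_tm :: "nat set \<Rightarrow> (nat \<Rightarrow> 'p) \<Rightarrow> ('f, 'p) tm \<Rightarrow> ('f, 'p) tm" where
  "inst_tm Y b (Var v) = (if v \<in> Y then Par (b v) else Var v)"
| "inst_tm Y b (Par a) = Par a"
| "inst_tm Y b (Fn f ts) = Fn f (map (inst_tm Y b) ts)"

primrec inst :: "nat set \<Rightarrow> (nat \<Rightarrow> 'p) \<Rightarrow> ('f, 'r, 'p) fm \<Rightarrow> ('f, 'r, 'p) fm" where
  "inst Y b Fls = Fls"
| "inst Y b (Eq s t) = Eq (inst_tm Y b s) (inst_tm Y b t)"
| "inst Y b (Rel r ts) = Rel r (map (inst_tm Y b) ts)"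
| "inst Y b (Neg \<phi>) = Neg (inst Y b \<phi>)"
| "inst Y b (Or \<phi> \<psi>) = Or (inst Y b \<phi>) (inst Y b \<psi>)"
| "inst Y b (Ex v \<phi>) = Ex v (inst (Y - {v}) b \<phi>)"

text \<open>A finite tuple \<open>x\<close> of variables is a finite set \<open>X\<close> of variables, and \<open>M\<^sup>x\<close> is
  the set of functions from \<open>X\<close> to the universe.  The concatenation of disjoint tuples
  \<open>x\<close>, \<open>y\<close> is \<open>X \<union> Y\<close>, so that \<open>xy\<close> and \<open>yx\<close> coincide.\<close>

definition tuples :: "('f, 'r, 'a) struct \<Rightarrow> nat set \<Rightarrow> (nat \<Rightarrow> 'a) set" where
  "tuples M X = X \<rightarrow>\<^sub>E univ M"

definition forms ::
  "('f, 'r) lang \<Rightarrow> ('f, 'r, 'a) struct \<Rightarrow> nat set \<Rightarrow> ('f, 'r, 'a) fm set" where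
  "forms L M X = {\<phi>. wf_fm L \<phi> \<and> fv \<phi> \<subseteq> X \<and> params \<phi> \<subseteq> univ M}"

definition solutions ::
  "('f, 'r, 'a) struct \<Rightarrow> nat set \<Rightarrow> ('f, 'r, 'a) fm \<Rightarrow> (nat \<Rightarrow> 'a) set" where
  "solutions M X \<phi> = {a \<in> tuples M X. sat M a \<phi>}"

definition tp ::
  "('f, 'r) lang \<Rightarrow> ('f, 'r, 'a) struct \<Rightarrow> nat set \<Rightarrow> (nat \<Rightarrow> 'a) \<Rightarrow> ('f, 'r, 'a) fm set" where
  "tp L M X a = {\<phi> \<in> forms L M X. sat M a \<phi>}"

definition types ::
  "('f, 'r) lang \<Rightarrow> ('f, 'r, 'a) struct \<Rightarrow> nat set \<Rightarrow> ('f, 'r, 'a) fm set set" where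
  "types L M X = {p. p \<subseteq> forms L M X \<and>
     (\<forall>q\<subseteq>p. finite q \<longrightarrow> (\<exists>a\<in>tuples M X. \<forall>\<phi>\<in>q. sat M a \<phi>)) \<and>
     (\<forall>\<phi>\<in>forms L M X. \<phi> \<in> p \<or> Neg \<phi> \<in> p)}"

definition basic_clopen ::
  "('f, 'r) lang \<Rightarrow> ('f, 'r, 'a) struct \<Rightarrow> nat set \<Rightarrow> ('f, 'r, 'a) fm \<Rightarrow> ('f, 'r, 'a) fm set set"
  where "basic_clopen L M X \<phi> = {p \<in> types L M X. \<phi> \<in> p}"

definition type_space ::
  "('f, 'r) lang \<Rightarrow> ('f, 'r, 'a) struct \<Rightarrow> nat set \<Rightarrow> ('f, 'r, 'a) fm set topology" where
  "type_space L M X = topology_generated_by (basic_clopen L M X ` forms L M X)"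

text \<open>A measure on \<open>L\<^sub>x(M)\<close> modulo equivalence in \<open>M\<close> is a function on formulas that
  takes equal values on equivalent formulas.  It is \<open>undefined\<close> outside \<open>forms L M X\<close>, so
  that HOL equality of such functions is equality of measures.\<close>

definition keisler ::
  "('f, 'r) lang \<Rightarrow> ('f, 'r, 'a) struct \<Rightarrow> nat set \<Rightarrow> (('f, 'r, 'a) fm \<Rightarrow> real) set" where
  "keisler L M X = {\<mu> \<in> extensional (forms L M X).
     (\<forall>\<phi>\<in>forms L M X. \<forall>\<psi>\<in>forms L M X. solutions M X \<phi> = solutions M X \<psi> \<longrightarrow> \<mu> \<phi> = \<mu> \<psi>) \<and>
     (\<forall>\<phi>\<in>forms L M X. 0 \<le> \<mu> \<phi>) \<and>
     \<mu> (Neg Fls) = 1 \<and>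
     (\<forall>\<phi>\<in>forms L M X. \<forall>\<psi>\<in>forms L M X.
        solutions M X \<phi> \<inter> solutions M X \<psi> = {} \<longrightarrow> \<mu> (Or \<phi> \<psi>) = \<mu> \<phi> + \<mu> \<psi>)}"

definition dirac ::
  "('f, 'r) lang \<Rightarrow> ('f, 'r, 'a) struct \<Rightarrow> nat set \<Rightarrow> ('f, 'r, 'a) fm set \<Rightarrow> ('f, 'r, 'a) fm \<Rightarrow> real"
  where "dirac L M X p = (\<lambda>\<phi>\<in>forms L M X. if \<phi> \<in> p then 1 else 0)"

definition conv_meas ::
  "('f, 'r) lang \<Rightarrow> ('f, 'r, 'a) struct \<Rightarrow> nat set \<Rightarrow> (('f, 'r, 'a) fm \<Rightarrow> real) set" where
  "conv_meas L M X =
     {(\<lambda>\<phi>\<in>forms L M X. \<Sum>i<n. r i * dirac L M X (tp L M X (a i)) \<phi>) |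
        (n :: nat) (r :: nat \<Rightarrow> real) a.
        n \<ge> 1 \<and> (\<forall>i<n. a i \<in> tuples M X) \<and> (\<forall>i<n. r i > 0) \<and> (\<Sum>i<n. r i) = 1}"

definition ultrafilter :: "'i filter \<Rightarrow> bool" where
  "ultrafilter D \<longleftrightarrow> D \<noteq> bot \<and> (\<forall>P. eventually P D \<or> eventually (\<lambda>i. \<not> P i) D)"

definition nonprincipal :: "'i filter \<Rightarrow> bool" where
  "nonprincipal D \<longleftrightarrow> (\<forall>i. D \<noteq> principal {i})"

definition ae_eq ::
  "'i filter \<Rightarrow> ('i \<Rightarrow> ('f, 'r, 'a) struct) \<Rightarrow> (('i \<Rightarrow> 'a) \<times> ('i \<Rightarrow> 'a)) set" where
  "ae_eq D M = {(f, g). (\<forall>i. f i \<in> univ (M i)) \<and> (\<forall>i. g i \<in> univ (M i)) \<and>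
                        eventually (\<lambda>i. f i = g i) D}"

definition rep :: "('i \<Rightarrow> 'a) set \<Rightarrow> 'i \<Rightarrow> 'a" where
  "rep b = (SOME f. f \<in> b)"

definition ultraproduct ::
  "'i filter \<Rightarrow> ('i \<Rightarrow> ('f, 'r, 'a) struct) \<Rightarrow> ('f, 'r, ('i \<Rightarrow> 'a) set) struct" where
  "ultraproduct D M =
    \<lparr> univ = {f. \<forall>i. f i \<in> univ (M i)} // ae_eq D M,
      finterp = (\<lambda>f bs. ae_eq D M `` {\<lambda>i. finterp (M i) f (map (\<lambda>b. rep b i) bs)}),
      rinterp = (\<lambda>r bs. eventually (\<lambda>i. rinterp (M i) r (map (\<lambda>b. rep b i) bs)) D) \<rparr>"

definition ultralimit ::
  "('f, 'r) lang \<Rightarrow> 'i filter \<Rightarrow> ('i \<Rightarrow> ('f, 'r, 'a) struct) \<Rightarrow> nat set \<Rightarrow>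
   ('i \<Rightarrow> ('f, 'r, 'a) fm \<Rightarrow> real) \<Rightarrow> ('f, 'r, ('i \<Rightarrow> 'a) set) fm \<Rightarrow> real" where
  "ultralimit L D M X \<mu>s =
     (\<lambda>\<phi>\<in>forms L (ultraproduct D M) X. Lim D (\<lambda>i. \<mu>s i (map_fm (\<lambda>b. rep b i) \<phi>)))"

definition pseudofinite ::
  "('f, 'r) lang \<Rightarrow> 'i filter \<Rightarrow> ('i \<Rightarrow> ('f, 'r, 'a) struct) \<Rightarrow> nat set \<Rightarrow>
   (('f, 'r, ('i \<Rightarrow> 'a) set) fm \<Rightarrow> real) \<Rightarrow> bool" where
  "pseudofinite L D M X \<mu> \<longleftrightarrow>
     (\<exists>\<mu>s. (\<forall>i. \<mu>s i \<in> conv_meas L (M i) X) \<and> \<mu> = ultralimit L D M X \<mu>s)"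

text \<open>\<open>F\<close> is a continuous extension to \<open>S\<^sub>y(M)\<close> of \<open>tp(b/M) \<mapsto> \<mu>(\<phi>(x,b))\<close>, where
  \<open>\<phi>(x,y)\<close> may contain parameters.  Requiring \<open>F\<close> to be \<open>undefined\<close> outside
  \<open>S\<^sub>y(M)\<close> makes it unique as a HOL function.\<close>

definition is_fiber_map ::
  "('f, 'r) lang \<Rightarrow> ('f, 'r, 'a) struct \<Rightarrow> nat set \<Rightarrow> (('f, 'r, 'a) fm \<Rightarrow> real) \<Rightarrow>
   ('f, 'r, 'a) fm \<Rightarrow> (('f, 'r, 'a) fm set \<Rightarrow> real) \<Rightarrow> bool" where
  "is_fiber_map L M Y \<mu> \<phi> F \<longleftrightarrow>
     F \<in> extensional (types L M Y) \<and>
     continuous_map (type_space L M Y) (top_of_set {0..1}) F \<and>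
     (\<forall>b\<in>tuples M Y. F (tp L M Y b) = \<mu> (inst Y b \<phi>))"

definition definable ::
  "('f, 'r) lang \<Rightarrow> ('f, 'r, 'a) struct \<Rightarrow> nat set \<Rightarrow> (('f, 'r, 'a) fm \<Rightarrow> real) \<Rightarrow> bool" where
  "definable L M X \<mu> \<longleftrightarrow>
     (\<forall>Y. finite Y \<longrightarrow> X \<inter> Y = {} \<longrightarrow>
        (\<forall>\<phi>\<in>forms L M (X \<union> Y). params \<phi> = {} \<longrightarrow> (\<exists>F. is_fiber_map L M Y \<mu> \<phi> F)))"

definition fiber_map ::
  "('f, 'r) lang \<Rightarrow> ('f, 'r, 'a) struct \<Rightarrow> nat set \<Rightarrow> (('f, 'r, 'a) fm \<Rightarrow> real) \<Rightarrow>
   ('f, 'r, 'a) fm \<Rightarrow> (('f, 'r, 'a) fm set \<Rightarrow> real)" where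
  "fiber_map L M Y \<mu> \<phi> = (THE F. is_fiber_map L M Y \<mu> \<phi> F)"

definition regular_borel_prob :: "'b topology \<Rightarrow> 'b measure \<Rightarrow> bool" where
  "regular_borel_prob T N \<longleftrightarrow>
     prob_space N \<and> sets N = sigma_sets (topspace T) {U. openin T U} \<and>
     (\<forall>B\<in>sets N.
        emeasure N B = (SUP K\<in>{K. compactin T K \<and> K \<subseteq> B}. emeasure N K) \<and>
        emeasure N B = (INF U\<in>{U. openin T U \<and> B \<subseteq> U}. emeasure N U))"

definition borel_extension ::
  "('f, 'r) lang \<Rightarrow> ('f, 'r, 'a) struct \<Rightarrow> nat set \<Rightarrow> (('f, 'r, 'a) fm \<Rightarrow> real) \<Rightarrow>
   ('f, 'r, 'a) fm set measure" where
  "borel_extension L M Y \<nu> =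
     (THE N. regular_borel_prob (type_space L M Y) N \<and>
             (\<forall>\<psi>\<in>forms L M Y. measure N (basic_clopen L M Y \<psi>) = \<nu> \<psi>))"

text \<open>\<open>morley L M X Y \<mu> \<nu>\<close> is \<open>\<mu> \<otimes> \<nu>\<close> for \<open>\<mu>\<close> definable in the variables
  \<open>X\<close> and \<open>\<nu>\<close> in the variables \<open>Y\<close>.\<close>

definition morley ::
  "('f, 'r) lang \<Rightarrow> ('f, 'r, 'a) struct \<Rightarrow> nat set \<Rightarrow> nat set \<Rightarrow>
   (('f, 'r, 'a) fm \<Rightarrow> real) \<Rightarrow> (('f, 'r, 'a) fm \<Rightarrow> real) \<Rightarrow> ('f, 'r, 'a) fm \<Rightarrow> real" where
  "morley L M X Y \<mu> \<nu> =
     (\<lambda>\<phi>\<in>forms L M (X \<union> Y). \<integral>p. fiber_map L M Y \<mu> \<phi> p \<partial>(borel_extension L M Y \<nu>))"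

end

theory Submission
  imports Defs
begin

text \<open>Both iterated integrals compute the same limit.  Write \<open>\<mu> = lim\<^sub>D \<mu>\<^sub>i\<close> and
  \<open>\<nu> = lim\<^sub>D \<nu>\<^sub>i\<close>, where \<open>\<mu>\<^sub>i\<close> is a convex combination of the Dirac measures at finitely many points
  \<open>a\<^sub>k\<close>, with weights \<open>r\<^sub>k\<close>, and \<open>\<nu>\<^sub>i\<close> one at points \<open>b\<^sub>l\<close>, with weights \<open>s\<^sub>l\<close>.  For a formula
  \<open>\<phi>(x,y)\<close> let \<open>A\<^sub>i\<close> be the sum of \<open>r\<^sub>k s\<^sub>l\<close> over all \<open>k, l\<close> for which \<open>\<phi>(a\<^sub>k,b\<^sub>l)\<close> holds in \<open>M\<^sub>i\<close>.
  A finite double sum may be evaluated in either order, so that it suffices to show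
  \<open>(\<mu> \<otimes> \<nu>)(\<phi>) = lim\<^sub>D A\<^sub>i\<close> (theorem \<open>product_average_tendsto_morley\<close>).

  Definability of \<open>\<mu>\<close> provides a continuous function \<open>F\<close> on the compact zero-dimensional
  space of types in \<open>y\<close> that extends \<open>b \<mapsto> \<mu>(\<phi>(x,b))\<close>.  Hence \<open>F\<close> is uniformly within \<open>\<delta>\<close> of a
  step function, a finite sum of terms \<open>c\<^sub>j 1\<^bsub>\<theta>\<^sub>j\<^esub>\<close> with formulas \<open>\<theta>\<^sub>j\<close>
  (\<open>step_approximation\<close>), and the integral of \<open>F\<close> is within \<open>\<delta>\<close> of the sum of the
  \<open>c\<^sub>j \<nu>(\<theta>\<^sub>j)\<close>.  The bound holds at \<^emph>\<open>all\<close> tuples \<open>b\<close> of the ultraproduct, and an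
  ultraproduct contains the class of every choice of tuples \<open>b\<^sub>i\<close>.  By the theorem of Los, for
  \<open>D\<close>-almost all \<open>i\<close> the function \<open>b \<mapsto> \<mu>\<^sub>i(\<phi>(x,b))\<close> is therefore within \<open>2 \<delta>\<close> of the same step
  function at all tuples \<open>b\<close> of \<open>M\<^sub>i\<close>: otherwise bad tuples \<open>b\<^sub>i\<close> would define a bad tuple of
  the ultraproduct (\<open>fiber_approximation_transfers\<close>).  Averaging over the \<open>b\<^sub>l\<close> shows that
  \<open>A\<^sub>i\<close> is within \<open>2 \<delta>\<close> of the sum of the \<open>c\<^sub>j \<nu>\<^sub>i(\<theta>\<^sub>j)\<close>, whose limit along \<open>D\<close> is the sum of the
  \<open>c\<^sub>j \<nu>(\<theta>\<^sub>j)\<close>.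

  The integral in the Morley product is taken with respect to a measure that the definitions
  only describe.  Its existence and uniqueness rest on compactness of the type space
  (\<open>compact_type_space\<close>) and on a Caratheodory construction that extends a finitely additive
  function on clopen sets to a regular measure on \<^emph>\<open>all\<close> Borel sets of a compact
  zero-dimensional space (locale \<open>clopen_content\<close>).  Likewise the functions \<open>F\<close> for formulas
  with parameters are obtained from those without (\<open>definable_fiber_map\<close>).\<close>

section \<open>Regular Borel measures from contents on clopen sets\<close>

text \<open>The open sets of \<open>T\<close> may form a much larger \<open>\<sigma>\<close>-algebra than the one generated by \<open>B\<close>
  when \<open>B\<close> is uncountable, so that the extension theorem for countably additive functions on
  rings does not reach all Borel sets.  The construction below goes through open sets instead:
  they are approximated by clopen sets from inside and approximate all sets from outside.\<close>

locale clopen_content =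
  fixes T :: "'b topology" and B :: "'b set set" and n :: "'b set \<Rightarrow> ennreal"
  assumes compact: "compact_space T"
    and alg: "algebra (topspace T) B"
    and B_open: "\<And>b. b \<in> B \<Longrightarrow> openin T b"
    and base: "\<And>U x. openin T U \<Longrightarrow> x \<in> U \<Longrightarrow> \<exists>b\<in>B. x \<in> b \<and> b \<subseteq> U"
    and add: "\<And>b c. b \<in> B \<Longrightarrow> c \<in> B \<Longrightarrow> b \<inter> c = {} \<Longrightarrow> n (b \<union> c) = n b + n c"
    and total: "n (topspace T) = 1"
begin

sublocale algebra "topspace T" B by (rule alg)

lemma content_mono:
  assumes "b \<in> B" "c \<in> B" "b \<subseteq> c" shows "n b \<le> n c"
proof -
  have "n c = n b + n (c - b)"
    using add[of b "c - b"] Diff[OF assms(2,1)] assms by (simp add: Un_absorb1)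
  then show ?thesis by simp
qed

lemma content_empty: "n {} = 0"
proof -
  have "n (topspace T) = n (topspace T) + n {}"
    using add[of "topspace T" "{}"] by simp
  then show ?thesis using total by simp
qed

lemma content_subadditive:
  assumes "finite J" "\<And>j. j \<in> J \<Longrightarrow> K j \<in> B"
  shows "n (\<Union>j\<in>J. K j) \<le> (\<Sum>j\<in>J. n (K j))"
  using assms
proof (induction J)
  case empty
  then show ?case by (simp add: content_empty)
next
  case (insert j J)
  have UN: "(\<Union>j\<in>J. K j) \<in> B" using insert by blast
  have "n (\<Union>i\<in>insert j J. K i) = n (K j) + n ((\<Union>i\<in>J. K i) - K j)"
    using add[of "K j" "(\<Union>i\<in>J. K i) - K j"] Diff[OF UN insert.prems[of j]] insert.prems by simp
  also have "\<dots> \<le> n (K j) + (\<Sum>i\<in>J. n (K i))"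
    using content_mono[of "(\<Union>i\<in>J. K i) - K j" "\<Union>i\<in>J. K i"] UN insert
    by (intro add_left_mono order_trans[OF _ insert.IH]) auto
  finally show ?case using insert.hyps by simp
qed

lemma clopen_compactin:
  assumes "b \<in> B" shows "compactin T b"
proof -
  have "closedin T b"
    using B_open[of "topspace T - b"] assms
    by (simp add: closedin_def openin_subset B_open compl_sets)
  then show ?thesis by (rule closedin_compact_space[OF compact])
qed

text \<open>Thanks to this interpolation a regular measure is determined by its values on \<open>B\<close>.\<close>

lemma compact_in_open_clopen:
  assumes K: "compactin T K" and U: "openin T U" "K \<subseteq> U"
  obtains b where "b \<in> B" "K \<subseteq> b" "b \<subseteq> U"
proof -
  let ?C = "{b \<in> B. b \<subseteq> U}"
  have "K \<subseteq> \<Union>?C" using base[OF U(1)] U(2) by blast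
  then obtain F where F: "finite F" "F \<subseteq> ?C" "K \<subseteq> \<Union>F"
    using compactinD[OF K, of ?C] B_open by auto
  moreover have "\<Union>F \<in> B" using F by auto
  ultimately show ?thesis by (intro that[of "\<Union>F"]) auto
qed

definition open_content :: "'b set \<Rightarrow> ennreal" where
  "open_content U = (SUP b\<in>{b \<in> B. b \<subseteq> U}. n b)"

definition outer :: "'b set \<Rightarrow> ennreal" where
  "outer A = (INF U\<in>{U. openin T U \<and> A \<subseteq> U}. open_content U)"

lemma open_content_mono: "U \<subseteq> V \<Longrightarrow> open_content U \<le> open_content V"
  unfolding open_content_def by (rule SUP_subset_mono) auto

lemma open_content_clopen: "b \<in> B \<Longrightarrow> open_content b = n b"
  unfolding open_content_def by (rule antisym) (auto intro!: SUP_least SUP_upper content_mono)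

lemma outer_open: "openin T U \<Longrightarrow> outer U = open_content U"
  unfolding outer_def by (rule antisym) (auto intro!: INF_greatest INF_lower open_content_mono)

lemma outer_mono: "A \<subseteq> A' \<Longrightarrow> outer A \<le> outer A'"
  unfolding outer_def by (rule INF_superset_mono) auto

lemma outer_empty: "outer {} = 0"
  using outer_open[of "{}"] open_content_clopen[of "{}"] content_empty by simp

text \<open>Compactness replaces countable additivity: a clopen subset of the union is covered by
  finitely many clopen sets, each inside one \<open>U i\<close>, and those inside the same \<open>U i\<close> are joined
  to a single clopen set \<open>K i\<close>.\<close>

lemma open_content_countably_subadditive:
  fixes U :: "nat \<Rightarrow> 'b set"
  assumes U: "\<And>i. openin T (U i)"
  shows "open_content (\<Union>i. U i) \<le> (\<Sum>i. open_content (U i))"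
  unfolding open_content_def[of "\<Union>i. U i"]
proof (rule SUP_least)
  fix C assume "C \<in> {b \<in> B. b \<subseteq> (\<Union>i. U i)}"
  then have C: "C \<in> B" "C \<subseteq> (\<Union>i. U i)" by auto
  let ?C = "{b \<in> B. \<exists>i. b \<subseteq> U i}"
  have "C \<subseteq> \<Union>?C"
  proof
    fix x assume "x \<in> C"
    then obtain i where i: "x \<in> U i" using C(2) by blast
    then obtain b where "b \<in> B" "x \<in> b" "b \<subseteq> U i" using base[OF U i] by blast
    then show "x \<in> \<Union>?C" by blast
  qed
  then obtain F where F: "finite F" "F \<subseteq> ?C" "C \<subseteq> \<Union>F"
    using compactinD[OF clopen_compactin[OF C(1)], of ?C] B_open by auto
  then have "\<forall>b\<in>F. \<exists>i. b \<subseteq> U i" by auto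
  then obtain ix where ix: "\<And>b. b \<in> F \<Longrightarrow> b \<subseteq> U (ix b)" by metis
  define K where "K i = \<Union>{b \<in> F. ix b = i}" for i
  have K: "K i \<in> B" "K i \<subseteq> U i" for i
    using F(1,2) ix[THEN subsetD] unfolding K_def by auto
  have KU: "(\<Union>i\<in>ix ` F. K i) \<in> B" using F(1) K(1) by blast
  have "C \<subseteq> (\<Union>i\<in>ix ` F. K i)"
  proof
    fix x assume "x \<in> C"
    then obtain b where "b \<in> F" "x \<in> b" using F(3) by blast
    then show "x \<in> (\<Union>i\<in>ix ` F. K i)" unfolding K_def by blast
  qed
  then have "n C \<le> n (\<Union>i\<in>ix ` F. K i)"
    by (intro content_mono C(1) KU)
  also have "\<dots> \<le> (\<Sum>i\<in>ix ` F. n (K i))"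
    using F(1) K(1) by (intro content_subadditive) auto
  also have "\<dots> \<le> (\<Sum>i\<in>ix ` F. open_content (U i))"
    unfolding open_content_def using K by (intro sum_mono SUP_upper) auto
  also have "\<dots> \<le> (\<Sum>i. open_content (U i))"
    using F(1) by (intro sum_le_suminf) auto
  finally show "n C \<le> (\<Sum>i. open_content (U i))" .
qed

lemma outer_close:
  assumes "outer A < e"
  obtains U where "openin T U" "A \<subseteq> U" "open_content U < e"
  using assms unfolding outer_def INF_less_iff by auto

lemma outer_countably_subadditive:
  fixes A :: "nat \<Rightarrow> 'b set"
  shows "outer (\<Union>i. A i) \<le> (\<Sum>i. outer (A i))"
proof (rule ennreal_le_epsilon)
  fix e :: real assume e: "0 < e" "(\<Sum>i. outer (A i)) < top"
  then have *: "outer (A i) < outer (A i) + e * (1/2)^Suc i" for i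
    by (auto simp add: less_top dest!: ennreal_suminf_lessD)
  have "\<exists>U. openin T U \<and> A i \<subseteq> U \<and> open_content U \<le> outer (A i) + e * (1/2)^Suc i" for i
    using outer_close[OF *[of i]] by (metis less_imp_le)
  then obtain U where U: "\<And>i. openin T (U i)" "\<And>i. A i \<subseteq> U i"
      "\<And>i. open_content (U i) \<le> outer (A i) + e * (1/2)^Suc i"
    by metis
  have "outer (\<Union>i. A i) \<le> outer (\<Union>i. U i)" using U(2) by (intro outer_mono) blast
  also have "\<dots> \<le> (\<Sum>i. open_content (U i))"
    using open_content_countably_subadditive[of U] U(1) by (subst outer_open) auto
  also have "\<dots> \<le> (\<Sum>i. outer (A i) + e * (1/2) ^ Suc i)"
    using U(3) by (intro suminf_le allI) auto
  also have "\<dots> = (\<Sum>i. outer (A i)) + (\<Sum>i. ennreal e * ennreal ((1/2) ^ Suc i))"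
    using e(1) by (subst suminf_add[symmetric])
      (auto simp del: ennreal_suminf_cmult simp add: ennreal_mult[symmetric])
  also have "\<dots> = (\<Sum>i. outer (A i)) + e"
    unfolding ennreal_suminf_cmult
    by (subst suminf_ennreal_eq[OF zero_le_power power_half_series]) auto
  finally show "outer (\<Union>i. A i) \<le> (\<Sum>i. outer (A i)) + e" .
qed

lemma outer_measure_space_outer: "outer_measure_space (Pow (topspace T)) outer"
  unfolding outer_measure_space_def positive_def increasing_def countably_subadditive_def
  by (auto intro: outer_empty outer_mono outer_countably_subadditive)

text \<open>For Caratheodory measurability of an open set \<open>U\<close>, cover the test set by an open \<open>V\<close>.
  Removing a clopen \<open>C \<subseteq> V \<inter> U\<close> from \<open>V\<close> leaves an open set, and finite additivity on disjoint
  clopen subsets of \<open>C\<close> and of \<open>V - C\<close> gives the required splitting in the supremum over \<open>C\<close>.\<close>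

lemma open_in_lambda_system:
  assumes U: "openin T U"
  shows "U \<in> lambda_system (topspace T) (Pow (topspace T)) outer"
proof -
  have Un: "outer E \<le> outer (E \<inter> U) + outer (E - U)" for E
  proof -
    have "outer E \<le> outer (\<Union>i. binaryset (E \<inter> U) (E - U) i)"
      by (intro outer_mono) (auto simp: UN_binaryset_eq)
    also have "\<dots> \<le> (\<Sum>i. outer (binaryset (E \<inter> U) (E - U) i))"
      by (rule outer_countably_subadditive)
    also have "\<dots> = outer (E \<inter> U) + outer (E - U)"
      by (rule suminf_binaryset_eq) (rule outer_empty)
    finally show ?thesis .
  qed
  have "outer (E \<inter> U) + outer (E - U) \<le> outer E" for E
    unfolding outer_def[of E]
  proof (rule INF_greatest, clarify)
    fix V assume V: "openin T V" "E \<subseteq> V"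
    have step: "n C + outer (E - U) \<le> open_content V" if C: "C \<in> B" "C \<subseteq> V \<inter> U" for C
    proof -
      have "V \<inter> (topspace T - C) = V - C" using openin_subset[OF V(1)] by blast
      then have VC: "openin T (V - C)"
        using openin_Int[OF V(1) B_open[OF compl_sets[OF C(1)]]] by simp
      have "n C + outer (E - U) \<le> n C + open_content (V - C)"
        using V(2) C(2) outer_open[OF VC] by (metis add_left_mono outer_mono Diff_mono Int_subset_iff)
      also have "\<dots> = (SUP C'\<in>{b \<in> B. b \<subseteq> V - C}. n C + n C')"
        unfolding open_content_def by (rule ennreal_SUP_add_right) auto
      also have "\<dots> \<le> open_content V"
      proof (rule SUP_least)
        fix C' assume C': "C' \<in> {b \<in> B. b \<subseteq> V - C}"
        then have "n C + n C' = n (C \<union> C')" using C(1) by (intro add[symmetric]) auto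
        also have "\<dots> \<le> open_content V"
          unfolding open_content_def using C C' by (intro SUP_upper) auto
        finally show "n C + n C' \<le> open_content V" .
      qed
      finally show ?thesis .
    qed
    have "outer (E \<inter> U) + outer (E - U) \<le> open_content (V \<inter> U) + outer (E - U)"
      using V outer_open[OF openin_Int[OF V(1) U]] by (metis add_right_mono outer_mono Int_mono order_refl)
    also have "\<dots> = (SUP C\<in>{b \<in> B. b \<subseteq> V \<inter> U}. n C + outer (E - U))"
      unfolding open_content_def by (rule ennreal_SUP_add_left[symmetric]) auto
    also have "\<dots> \<le> open_content V" using step by (intro SUP_least) auto
    finally show "outer (E \<inter> U) + outer (E - U) \<le> open_content V" .
  qed
  with Un have "outer (E \<inter> U) + outer (E - U) = outer E" for E by (intro antisym) auto
  then show ?thesis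
    using openin_subset[OF U] unfolding algebra.lambda_system_eq[OF algebra_Pow] by auto
qed

definition ext_measure :: "'b measure" where
  "ext_measure = measure_of (topspace T) {U. openin T U} outer"

lemma sets_ext: "sets ext_measure = sigma_sets (topspace T) {U. openin T U}"
  unfolding ext_measure_def by (intro sets_measure_of) (auto dest: openin_subset)

lemma space_ext: "space ext_measure = topspace T"
  unfolding ext_measure_def by (intro space_measure_of) (auto dest: openin_subset)

lemma emeasure_ext:
  assumes "A \<in> sets ext_measure" shows "emeasure ext_measure A = outer A"
proof -
  let ?S = "sigma_sets (topspace T) {U. openin T U}"
  have ms: "measure_space (topspace T) (lambda_system (topspace T) (Pow (topspace T)) outer) outer"
    by (rule sigma_algebra.caratheodory_lemma[OF sigma_algebra_Pow outer_measure_space_outer])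
  then have "?S \<subseteq> lambda_system (topspace T) (Pow (topspace T)) outer"
    by (intro sigma_algebra.sigma_sets_subset) (auto simp: measure_space_def open_in_lambda_system)
  then have "measure_space (topspace T) ?S outer"
    by (intro measure_down[OF ms] sigma_algebra_sigma_sets) (auto dest: openin_subset)
  then show ?thesis
    using assms sets_ext
    by (intro emeasure_measure_of[OF ext_measure_def]) (auto simp: measure_space_def dest: openin_subset)
qed

lemma open_in_sets: "openin T U \<Longrightarrow> U \<in> sets ext_measure"
  unfolding sets_ext by auto

lemma prob_space_ext: "prob_space ext_measure"
  using emeasure_ext[of "topspace T"] outer_open[of "topspace T"] open_content_clopen[of "topspace T"]
    total open_in_sets[of "topspace T"] by (intro prob_spaceI) (simp add: space_ext top)

lemma emeasure_ext_clopen: "b \<in> B \<Longrightarrow> emeasure ext_measure b = n b"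
  using emeasure_ext[of b] open_in_sets[of b] B_open outer_open open_content_clopen by simp

lemma ext_outer_regular:
  assumes A: "A \<in> sets ext_measure"
  shows "emeasure ext_measure A = (INF U\<in>{U. openin T U \<and> A \<subseteq> U}. emeasure ext_measure U)"
  using emeasure_ext open_in_sets outer_open
  by (simp add: emeasure_ext[OF A] outer_def cong: INF_cong_simp)

text \<open>Outer regularity of the complement, as complements of open sets are compact here.\<close>

lemma ext_inner_regular:
  assumes A: "A \<in> sets ext_measure"
  shows "emeasure ext_measure A = (SUP K\<in>{K. compactin T K \<and> K \<subseteq> A}. emeasure ext_measure K)"
proof (rule antisym)
  interpret N: prob_space ext_measure by (rule prob_space_ext)
  let ?A = "topspace T - A"
  have A': "?A \<in> sets ext_measure" using A by (metis sets.compl_sets space_ext)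
  show "emeasure ext_measure A \<le> (SUP K\<in>{K. compactin T K \<and> K \<subseteq> A}. emeasure ext_measure K)"
  proof (rule ennreal_le_epsilon)
    fix e :: real assume e: "0 < e"
    have "outer ?A \<noteq> \<infinity>" by (simp flip: emeasure_ext[OF A'])
    then have "outer ?A < outer ?A + e" using e by (simp add: less_top)
    then obtain U where U: "openin T U" "?A \<subseteq> U" "open_content U < outer ?A + e"
      by (rule outer_close)
    let ?K = "topspace T - U"
    have K: "compactin T ?K" "?K \<subseteq> A"
      using U openin_subset[of T U] by (auto intro!: closedin_compact_space[OF compact])
    have Us: "U \<in> sets ext_measure" by (rule open_in_sets[OF U(1)])
    have "emeasure ext_measure U \<le> emeasure ext_measure ?A + e"
      using U(1,3) emeasure_ext[OF A'] emeasure_ext[OF Us] outer_open by simp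
    then have "N.prob U \<le> N.prob ?A + e"
      using e by (simp add: N.emeasure_eq_measure flip: ennreal_plus)
    then have "N.prob A \<le> N.prob ?K + e"
      using N.prob_compl[OF A] N.prob_compl[OF Us] by (simp add: space_ext)
    then have "emeasure ext_measure A \<le> emeasure ext_measure ?K + e"
      using e by (simp add: N.emeasure_eq_measure flip: ennreal_plus)
    also have "\<dots> \<le> (SUP K\<in>{K. compactin T K \<and> K \<subseteq> A}. emeasure ext_measure K) + e"
      using K by (intro add_right_mono SUP_upper) auto
    finally show "emeasure ext_measure A
        \<le> (SUP K\<in>{K. compactin T K \<and> K \<subseteq> A}. emeasure ext_measure K) + e" .
  qed
  show "(SUP K\<in>{K. compactin T K \<and> K \<subseteq> A}. emeasure ext_measure K) \<le> emeasure ext_measure A"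
    using A by (intro SUP_least emeasure_mono) auto
qed

lemma regular_ext: "regular_borel_prob T ext_measure"
  unfolding regular_borel_prob_def
  using prob_space_ext sets_ext ext_inner_regular ext_outer_regular by blast

text \<open>Two regular measures that agree on \<open>B\<close> agree on open sets by inner regularity and
  \<open>compact_in_open_clopen\<close>, hence everywhere by outer regularity.\<close>

lemma regular_eqI:
  assumes N: "regular_borel_prob T N" and N': "regular_borel_prob T N'"
    and eq: "\<And>b. b \<in> B \<Longrightarrow> emeasure N b = emeasure N' b"
  shows "N = N'"
proof -
  have le: "emeasure P U \<le> emeasure Q U"
    if P: "regular_borel_prob T P" and Q: "regular_borel_prob T Q"
      and PQ: "\<And>b. b \<in> B \<Longrightarrow> emeasure P b = emeasure Q b" and U: "openin T U" for P Q U
  proof -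
    have sP: "sets P = sigma_sets (topspace T) {U. openin T U}"
      and sQ: "sets Q = sigma_sets (topspace T) {U. openin T U}"
      using P Q by (auto simp: regular_borel_prob_def)
    have UP: "U \<in> sets P" "U \<in> sets Q" using U unfolding sP sQ by auto
    have "emeasure P U = (SUP K\<in>{K. compactin T K \<and> K \<subseteq> U}. emeasure P K)"
      using P UP unfolding regular_borel_prob_def by blast
    also have "\<dots> \<le> emeasure Q U"
    proof (rule SUP_least, clarify)
      fix K assume K: "compactin T K" "K \<subseteq> U"
      obtain b where b: "b \<in> B" "K \<subseteq> b" "b \<subseteq> U"
        using compact_in_open_clopen[OF K(1) U K(2)] .
      have "b \<in> sets P" using B_open[OF b(1)] unfolding sP by auto
      then have "emeasure P K \<le> emeasure P b" using b by (intro emeasure_mono) auto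
      also have "\<dots> \<le> emeasure Q U" using b UP PQ by (auto intro!: emeasure_mono)
      finally show "emeasure P K \<le> emeasure Q U" .
    qed
    finally show ?thesis .
  qed
  have op: "emeasure N U = emeasure N' U" if "openin T U" for U
    using le[OF N N' eq that] le[OF N' N eq[symmetric] that] by simp
  show ?thesis
  proof (rule measure_eqI)
    show "sets N = sets N'" using N N' by (auto simp: regular_borel_prob_def)
    fix A assume A: "A \<in> sets N"
    then have A': "A \<in> sets N'" using \<open>sets N = sets N'\<close> by simp
    have "emeasure N A = (INF U\<in>{U. openin T U \<and> A \<subseteq> U}. emeasure N U)"
      using N A unfolding regular_borel_prob_def by blast
    also have "\<dots> = (INF U\<in>{U. openin T U \<and> A \<subseteq> U}. emeasure N' U)"
      using op by (intro INF_cong) auto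
    also have "\<dots> = emeasure N' A"
      using N' A' unfolding regular_borel_prob_def by (metis (no_types, lifting))
    finally show "emeasure N A = emeasure N' A" .
  qed
qed

end

section \<open>Substitution and abstraction of parameters\<close>

lemma eval_tm_cong:
  "(\<And>v. v \<in> fv_tm t \<Longrightarrow> e v = e' v) \<Longrightarrow> eval_tm M e t = eval_tm M e' t"
proof (induction t)
  case (Fn f ts)
  have "eval_tm M e t = eval_tm M e' t" if "t \<in> set ts" for t
    by (rule Fn.IH[OF that]) (use Fn.prems that in auto)
  then show ?case by (simp cong: map_cong)
qed auto

lemma sat_cong:
  "(\<And>v. v \<in> fv \<phi> \<Longrightarrow> e v = e' v) \<Longrightarrow> sat M e \<phi> = sat M e' \<phi>"
proof (induction \<phi> arbitrary: e e')
  case (Eq s t)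
  then show ?case using eval_tm_cong[of s e e' M] eval_tm_cong[of t e e' M] by simp
next
  case (Rel r ts)
  have "map (eval_tm M e) ts = map (eval_tm M e') ts"
    using Rel by (auto intro!: eval_tm_cong)
  then show ?case by (simp only: sat.simps)
next
  case (Neg \<phi>)
  have "sat M e \<phi> = sat M e' \<phi>" by (rule Neg.IH) (use Neg.prems in auto)
  then show ?case by simp
next
  case (Or \<phi> \<psi>)
  have "sat M e \<phi> = sat M e' \<phi>" by (rule Or.IH) (use Or.prems in auto)
  moreover have "sat M e \<psi> = sat M e' \<psi>" by (rule Or.IH) (use Or.prems in auto)
  ultimately show ?case by simp
next
  case (Ex v \<phi>)
  have "sat M (e(v := a)) \<phi> = sat M (e'(v := a)) \<phi>" for a
    by (rule Ex.IH) (use Ex.prems in auto)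
  then show ?case by simp
qed simp

lemma eval_inst_tm: "eval_tm M e (inst_tm Y b t) = eval_tm M (override_on e b Y) t"
  by (induction t) (auto simp: override_on_def cong: map_cong)

text \<open>Parameters are closed terms, so that substituting them never captures a variable; only the
  valuation changes.\<close>

lemma sat_inst: "sat M e (inst Y b \<phi>) = sat M (override_on e b Y) \<phi>"
proof (induction \<phi> arbitrary: e Y)
  case (Ex v \<phi>)
  have "override_on (e(v := a)) b (Y - {v}) = (override_on e b Y)(v := a)" for a
    by (auto simp: override_on_def)
  then show ?case by (simp add: Ex.IH del: fun_upd_apply)
qed (simp_all add: eval_inst_tm comp_def)

lemma fv_inst_tm: "fv_tm (inst_tm Y b t) = fv_tm t - Y"
  by (induction t) auto

lemma fv_inst: "fv (inst Y b \<phi>) = fv \<phi> - Y"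
  by (induction \<phi> arbitrary: Y) (auto simp: fv_inst_tm)

lemma wf_inst_tm: "wf_tm L (inst_tm Y b t) = wf_tm L t"
  by (induction t) (auto simp: list_all_iff)

lemma wf_inst: "wf_fm L (inst Y b \<phi>) = wf_fm L \<phi>"
  by (induction \<phi> arbitrary: Y) (auto simp: wf_inst_tm)

lemma params_inst_tm: "params_tm (inst_tm Y b t) \<subseteq> params_tm t \<union> b ` Y"
  by (induction t) auto

lemma params_inst: "params (inst Y b \<phi>) \<subseteq> params \<phi> \<union> b ` Y"
proof (induction \<phi> arbitrary: Y)
  case (Rel r ts)
  then show ?case using params_inst_tm by fastforce
next
  case (Eq s t)
  then show ?case using params_inst_tm[of Y b s] params_inst_tm[of Y b t] by auto
next
  case (Or \<phi> \<psi>)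
  then show ?case by fastforce
next
  case (Ex v \<phi>)
  then show ?case using Ex[of "Y - {v}"] by auto
qed auto

lemma inst_forms:
  assumes "\<phi> \<in> forms L M Z" "Z \<subseteq> X \<union> Y" "b \<in> tuples M Y"
  shows "inst Y b \<phi> \<in> forms L M X"
proof -
  have "b ` Y \<subseteq> univ M" using assms(3) by (auto simp: tuples_def)
  then show ?thesis
    using assms(1,2) order_trans[OF params_inst[of Y b \<phi>], of "univ M"]
    by (auto simp: forms_def fv_inst wf_inst)
qed

lemma inst_inst_tm:
  assumes "\<And>v. v \<in> Z \<Longrightarrow> d v = c v" "\<And>v. v \<in> Y - Z \<Longrightarrow> d v = b v"
  shows "inst_tm Y b (inst_tm Z c t) = inst_tm (Y \<union> Z) d t"
  using assms by (induction t) auto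

lemma inst_inst:
  assumes "\<And>v. v \<in> Z \<Longrightarrow> d v = c v" "\<And>v. v \<in> Y - Z \<Longrightarrow> d v = b v"
  shows "inst Y b (inst Z c \<phi>) = inst (Y \<union> Z) d \<phi>"
  using assms
proof (induction \<phi> arbitrary: Y Z)
  case (Ex v \<phi>)
  have "inst (Y - {v}) b (inst (Z - {v}) c \<phi>) = inst ((Y - {v}) \<union> (Z - {v})) d \<phi>"
    by (rule Ex.IH) (use Ex.prems in auto)
  then show ?case by (simp add: Un_Diff)
next
  case (Eq s t)
  have "inst_tm Y b (inst_tm Z c s) = inst_tm (Y \<union> Z) d s"
    by (rule inst_inst_tm) (use Eq in auto)
  moreover have "inst_tm Y b (inst_tm Z c t) = inst_tm (Y \<union> Z) d t"
    by (rule inst_inst_tm) (use Eq in auto)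
  ultimately show ?case by simp
next
  case (Rel r ts)
  have "inst_tm Y b (inst_tm Z c t) = inst_tm (Y \<union> Z) d t" if "t \<in> set ts" for t
    by (rule inst_inst_tm) (use Rel in auto)
  then show ?case by simp
qed simp_all

lemma inst_tm_cong: "(\<And>v. v \<in> Y \<Longrightarrow> b v = b' v) \<Longrightarrow> inst_tm Y b t = inst_tm Y b' t"
  by (induction t) auto

lemma inst_cong: "(\<And>v. v \<in> Y \<Longrightarrow> b v = b' v) \<Longrightarrow> inst Y b \<phi> = inst Y b' \<phi>"
proof (induction \<phi> arbitrary: Y)
  case (Ex v \<phi>)
  have "inst (Y - {v}) b \<phi> = inst (Y - {v}) b' \<phi>"
    by (rule Ex.IH) (use Ex.prems in auto)
  then show ?case by simp
next
  case (Eq s t)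
  show ?case using inst_tm_cong[of Y b b' s] inst_tm_cong[of Y b b' t] Eq by simp
next
  case (Rel r ts)
  have "inst_tm Y b t = inst_tm Y b' t" if "t \<in> set ts" for t
    by (rule inst_tm_cong) (rule Rel)
  then show ?case by simp
qed simp_all

lemma map_inst_tm: "map_tm g (inst_tm Y b t) = inst_tm Y (g \<circ> b) (map_tm g t)"
  by (induction t) auto

lemma map_inst: "map_fm g (inst Y b \<phi>) = inst Y (g \<circ> b) (map_fm g \<phi>)"
  by (induction \<phi> arbitrary: Y) (auto simp: map_inst_tm)

lemma fv_map_tm: "fv_tm (map_tm g t) = fv_tm t"
  by (induction t) auto

lemma fv_map: "fv (map_fm g \<phi>) = fv \<phi>"
  by (induction \<phi>) (auto simp: fv_map_tm)

lemma wf_map_tm: "wf_tm L (map_tm g t) = wf_tm L t"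
  by (induction t) (auto simp: list_all_iff)

lemma wf_map: "wf_fm L (map_fm g \<phi>) = wf_fm L \<phi>"
  by (induction \<phi>) (auto simp: wf_map_tm)

text \<open>All variables, including bound ones: a variable that is to replace a parameter has to avoid
  them, or a quantifier could capture it.\<close>

primrec vars :: "('f, 'r, 'p) fm \<Rightarrow> nat set" where
  "vars Fls = {}"
| "vars (Eq s t) = fv_tm s \<union> fv_tm t"
| "vars (Rel r ts) = \<Union> (fv_tm ` set ts)"
| "vars (Neg \<phi>) = vars \<phi>"
| "vars (Or \<phi> \<psi>) = vars \<phi> \<union> vars \<psi>"
| "vars (Ex v \<phi>) = insert v (vars \<phi>)"

lemma finite_fv_tm: "finite (fv_tm t)"
  by (induction t) auto

lemma finite_vars: "finite (vars \<phi>)"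
  by (induction \<phi>) (auto simp: finite_fv_tm)

lemma finite_params_tm: "finite (params_tm t)"
  by (induction t) auto

lemma finite_params: "finite (params \<phi>)"
  by (induction \<phi>) (auto simp: finite_params_tm)

text \<open>The inverse of substitution: the parameter \<open>a\<close> becomes the variable \<open>h a\<close>.\<close>

primrec unpar_tm :: "('p \<Rightarrow> nat) \<Rightarrow> ('f, 'p) tm \<Rightarrow> ('f, 'p) tm" where
  "unpar_tm h (Var v) = Var v"
| "unpar_tm h (Par a) = Var (h a)"
| "unpar_tm h (Fn f ts) = Fn f (map (unpar_tm h) ts)"

primrec unpar :: "('p \<Rightarrow> nat) \<Rightarrow> ('f, 'r, 'p) fm \<Rightarrow> ('f, 'r, 'p) fm" where
  "unpar h Fls = Fls"
| "unpar h (Eq s t) = Eq (unpar_tm h s) (unpar_tm h t)"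
| "unpar h (Rel r ts) = Rel r (map (unpar_tm h) ts)"
| "unpar h (Neg \<phi>) = Neg (unpar h \<phi>)"
| "unpar h (Or \<phi> \<psi>) = Or (unpar h \<phi>) (unpar h \<psi>)"
| "unpar h (Ex v \<phi>) = Ex v (unpar h \<phi>)"

lemma fv_unpar_tm: "fv_tm (unpar_tm h t) \<subseteq> fv_tm t \<union> h ` params_tm t"
proof (induction t)
  case (Fn f ts)
  have "fv_tm (unpar_tm h t) \<subseteq> \<Union>(fv_tm ` set ts) \<union> h ` \<Union>(params_tm ` set ts)" if "t \<in> set ts" for t
    by (rule order_trans[OF Fn.IH[OF that]], rule Un_mono) (use that in auto)
  then show ?case by (simp only: unpar_tm.simps fv_tm.simps tm.set set_map image_image UN_subset_iff) blast
qed auto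

lemma fv_unpar: "fv (unpar h \<phi>) \<subseteq> fv \<phi> \<union> h ` params \<phi>"
proof (induction \<phi>)
  case (Eq s t)
  then show ?case using fv_unpar_tm[of h s] fv_unpar_tm[of h t] by auto
next
  case (Rel r ts)
  then show ?case using fv_unpar_tm by fastforce
qed auto

lemma params_unpar_tm: "params_tm (unpar_tm h t) = {}"
  by (induction t) auto

lemma params_unpar: "params (unpar h \<phi>) = {}"
  by (induction \<phi>) (auto simp: params_unpar_tm)

lemma wf_unpar_tm: "wf_tm L (unpar_tm h t) = wf_tm L t"
  by (induction t) (auto simp: list_all_iff)

lemma wf_unpar: "wf_fm L (unpar h \<phi>) = wf_fm L \<phi>"
  by (induction \<phi>) (auto simp: wf_unpar_tm)

lemma inst_unpar_tm:
  assumes "\<And>a. a \<in> params_tm t \<Longrightarrow> h a \<in> Z \<and> c (h a) = a" "Z \<inter> fv_tm t = {}"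
  shows "inst_tm Z c (unpar_tm h t) = t"
  using assms
proof (induction t)
  case (Fn f ts)
  have "inst_tm Z c (unpar_tm h t) = t" if "t \<in> set ts" for t
    by (rule Fn.IH) (use Fn.prems that in auto)
  then show ?case by (simp add: map_idI)
qed auto

lemma inst_unpar:
  assumes "\<And>a. a \<in> params \<phi> \<Longrightarrow> h a \<in> Z \<and> c (h a) = a" "Z \<inter> vars \<phi> = {}"
  shows "inst Z c (unpar h \<phi>) = \<phi>"
  using assms
proof (induction \<phi>)
  case (Eq s t)
  then show ?case using inst_unpar_tm[of s h Z c] inst_unpar_tm[of t h Z c] by auto
next
  case (Rel r ts)
  have "inst_tm Z c (unpar_tm h t) = t" if "t \<in> set ts" for t
    by (rule inst_unpar_tm) (use Rel.prems that in auto)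
  then show ?case by (simp add: map_idI)
next
  case (Ex v \<phi>)
  then have "Z - {v} = Z" by auto
  with Ex show ?case by auto
next
  case (Or \<phi> \<psi>)
  then show ?case by auto
qed auto

text \<open>Every formula with parameters is \<open>\<phi>\<^sub>0(x,c)\<close> for a formula \<open>\<phi>\<^sub>0(x,z)\<close> without parameters,
  where \<open>z\<close> avoids a given finite set.  Definability speaks about formulas without parameters, whereas
  the Morley product needs all of them.\<close>

lemma forms_parameter_free:
  assumes \<phi>: "\<phi> \<in> forms L M X" and V: "finite V"
  obtains Z c \<phi>0 where "finite Z" "Z \<inter> V = {}" "c \<in> tuples M Z" "\<phi>0 \<in> forms L M (X \<union> Z)"
    "params \<phi>0 = {}" "inst Z c \<phi>0 = \<phi>"
proof -
  obtain g :: "_ \<Rightarrow> nat" where g: "inj_on g (params \<phi>)"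
    using finite_imp_inj_to_nat_seg[OF finite_params[of \<phi>]] by blast
  obtain N where N: "\<And>v. v \<in> V \<union> vars \<phi> \<Longrightarrow> v < N"
    using V finite_vars[of \<phi>] finite_nat_set_iff_bounded[of "V \<union> vars \<phi>"] by auto
  \<comment> \<open>Shifting by \<open>N\<close> moves the new variables beyond all those in use.\<close>
  define h where "h a = N + g a" for a
  have h: "inj_on h (params \<phi>)" using g by (auto simp: h_def inj_on_def)
  let ?Z = "h ` params \<phi>"
  let ?c = "restrict (the_inv_into (params \<phi>) h) ?Z"
  have disj: "?Z \<inter> (V \<union> vars \<phi>) = {}" using N by (force simp: h_def)
  have c: "?c (h a) = a" if "a \<in> params \<phi>" for a
    using h that by (simp add: the_inv_into_f_f)
  show ?thesis
  proof (rule that)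
    show "?c \<in> tuples M ?Z"
      using \<phi> h by (auto simp: tuples_def forms_def the_inv_into_f_f)
    show "unpar h \<phi> \<in> forms L M (X \<union> ?Z)"
      using \<phi> fv_unpar[of h \<phi>] by (auto simp: forms_def wf_unpar params_unpar)
    show "inst ?Z ?c (unpar h \<phi>) = \<phi>"
      using disj c by (intro inst_unpar) auto
  qed (use disj finite_params[of \<phi>] in \<open>auto simp: params_unpar\<close>)
qed

lemma override_tuples:
  assumes "a \<in> tuples M X" "b \<in> tuples M Y"
  shows "override_on a b Y \<in> tuples M (X \<union> Y)"
  using assms by (auto simp: tuples_def override_on_def PiE_iff extensional_def)

section \<open>Compactness of type spaces\<close>

lemma Fls_forms [simp]: "Fls \<in> forms L M X"
  and Neg_forms [simp]: "Neg \<phi> \<in> forms L M X \<longleftrightarrow> \<phi> \<in> forms L M X"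
  and Or_forms [simp]: "Or \<phi> \<psi> \<in> forms L M X \<longleftrightarrow> \<phi> \<in> forms L M X \<and> \<psi> \<in> forms L M X"
  by (auto simp: forms_def)

text \<open>Any finite part of a type, including the formulas that the type omits, is decided by an
  actual tuple.  All Boolean laws for types are instances.\<close>

lemma type_finitely_realized:
  assumes p: "p \<in> types L M X" and Q: "finite Q" "Q \<subseteq> forms L M X"
  obtains a where "a \<in> tuples M X" "\<And>\<phi>. \<phi> \<in> Q \<Longrightarrow> \<phi> \<in> p \<longleftrightarrow> sat M a \<phi>"
proof -
  \<comment> \<open>Completeness of \<open>p\<close> puts the negations of omitted formulas into \<open>p\<close>.\<close>
  let ?q = "(Q \<inter> p) \<union> Neg ` (Q - p)"
  have complete: "\<phi> \<in> p \<or> Neg \<phi> \<in> p" if "\<phi> \<in> forms L M X" for \<phi>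
    using p that by (simp add: types_def)
  have realized: "\<exists>a\<in>tuples M X. \<forall>\<phi>\<in>q. sat M a \<phi>" if "q \<subseteq> p" "finite q" for q
    using p that by (simp add: types_def)
  have "?q \<subseteq> p"
  proof (intro Un_least subsetI)
    fix \<rho> assume "\<rho> \<in> Neg ` (Q - p)"
    then obtain \<phi> where "\<phi> \<in> Q" "\<phi> \<notin> p" "\<rho> = Neg \<phi>" by (elim imageE DiffE)
    then show "\<rho> \<in> p" using complete Q(2) by (metis subsetD)
  qed simp
  moreover have "finite ?q" using Q(1) by simp
  ultimately have "\<exists>a\<in>tuples M X. \<forall>\<phi>\<in>?q. sat M a \<phi>" by (rule realized)
  then obtain a where a: "a \<in> tuples M X" "\<And>\<phi>. \<phi> \<in> ?q \<Longrightarrow> sat M a \<phi>" by (elim bexE) simp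
  show ?thesis
  proof (rule that[OF a(1)])
    fix \<phi> assume "\<phi> \<in> Q"
    then show "\<phi> \<in> p \<longleftrightarrow> sat M a \<phi>" using a(2)[of \<phi>] a(2)[of "Neg \<phi>"] by (cases "\<phi> \<in> p") simp_all
  qed
qed

lemma type_Neg:
  assumes "p \<in> types L M X" "\<phi> \<in> forms L M X"
  shows "Neg \<phi> \<in> p \<longleftrightarrow> \<phi> \<notin> p"
  by (rule type_finitely_realized[OF assms(1), of "{\<phi>, Neg \<phi>}"]) (use assms in auto)

lemma type_Or:
  assumes "p \<in> types L M X" "\<phi> \<in> forms L M X" "\<psi> \<in> forms L M X"
  shows "Or \<phi> \<psi> \<in> p \<longleftrightarrow> \<phi> \<in> p \<or> \<psi> \<in> p"
  by (rule type_finitely_realized[OF assms(1), of "{\<phi>, \<psi>, Or \<phi> \<psi>}"]) (use assms in auto)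

lemma type_Fls: "p \<in> types L M X \<Longrightarrow> Fls \<notin> p"
  by (rule type_finitely_realized[of p L M X "{Fls}"]) auto

lemma tp_types: "a \<in> tuples M X \<Longrightarrow> tp L M X a \<in> types L M X"
  by (auto simp: types_def tp_def)

lemma in_tp: "\<phi> \<in> forms L M X \<Longrightarrow> \<phi> \<in> tp L M X a \<longleftrightarrow> sat M a \<phi>"
  by (simp add: tp_def)

lemma basic_clopen_Or:
  "\<phi> \<in> forms L M X \<Longrightarrow> \<psi> \<in> forms L M X \<Longrightarrow>
    basic_clopen L M X (Or \<phi> \<psi>) = basic_clopen L M X \<phi> \<union> basic_clopen L M X \<psi>"
  by (auto simp: basic_clopen_def type_Or)

lemma basic_clopen_Neg:
  "\<phi> \<in> forms L M X \<Longrightarrow> basic_clopen L M X (Neg \<phi>) = types L M X - basic_clopen L M X \<phi>"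
  by (auto simp: basic_clopen_def type_Neg)

lemma basic_clopen_Fls: "basic_clopen L M X Fls = {}"
  by (auto simp: basic_clopen_def type_Fls)

lemma solutions_eq_basic_clopen:
  "\<phi> \<in> forms L M X \<Longrightarrow> solutions M X \<phi> = {a \<in> tuples M X. tp L M X a \<in> basic_clopen L M X \<phi>}"
  by (auto simp: solutions_def basic_clopen_def tp_types in_tp)

abbreviation clopens where "clopens L M X \<equiv> basic_clopen L M X ` forms L M X"

lemma topspace_type_space [simp]: "topspace (type_space L M X) = types L M X"
proof -
  have "basic_clopen L M X (Neg Fls) = types L M X"
    by (simp add: basic_clopen_Neg basic_clopen_Fls)
  then show ?thesis
    unfolding type_space_def topology_generated_by_topspace
    by (auto simp: basic_clopen_def intro!: bexI[of _ "Neg Fls"])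
qed

lemma algebra_clopens: "algebra (types L M X) (clopens L M X)"
proof (subst algebra_iff_Un, safe)
  show "x \<in> types L M X" if "x \<in> basic_clopen L M X \<phi>" for x \<phi>
    using that by (simp add: basic_clopen_def)
  show "{} \<in> clopens L M X"
    using basic_clopen_Fls by (metis Fls_forms image_eqI)
  show "types L M X - basic_clopen L M X \<phi> \<in> clopens L M X" if "\<phi> \<in> forms L M X" for \<phi>
    using that by (auto simp flip: basic_clopen_Neg)
  show "basic_clopen L M X \<phi> \<union> basic_clopen L M X \<psi> \<in> clopens L M X"
    if "\<phi> \<in> forms L M X" "\<psi> \<in> forms L M X" for \<phi> \<psi>
    using that by (auto simp flip: basic_clopen_Or)
qed

lemma openin_clopen: "\<phi> \<in> forms L M X \<Longrightarrow> openin (type_space L M X) (basic_clopen L M X \<phi>)"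
  unfolding type_space_def by (rule topology_generated_by_Basis) auto

text \<open>The clopen sets given by formulas are closed under intersection, so that the subbase in
  the definition of the topology is a base.\<close>

lemma clopen_base:
  assumes "openin (type_space L M X) U" "p \<in> U"
  obtains \<phi> where "\<phi> \<in> forms L M X" "p \<in> basic_clopen L M X \<phi>" "basic_clopen L M X \<phi> \<subseteq> U"
proof -
  interpret algebra "types L M X" "clopens L M X" by (rule algebra_clopens)
  have "generate_topology_on (clopens L M X) U"
    using assms(1) unfolding type_space_def by (rule openin_topology_generated_by)
  then have "\<exists>b\<in>clopens L M X. p \<in> b \<and> b \<subseteq> U" using assms(2)
  proof (induction)
    case (Int a b)
    then obtain c d where "c \<in> clopens L M X" "p \<in> c" "c \<subseteq> a" "d \<in> clopens L M X" "p \<in> d" "d \<subseteq> b"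
      by blast
    then show ?case by (intro bexI[of _ "c \<inter> d"]) blast+
  next
    case (UN K)
    then obtain k where k: "k \<in> K" "p \<in> k" by blast
    then obtain b where "b \<in> clopens L M X" "p \<in> b" "b \<subseteq> k" using UN.IH by meson
    then show ?case using k(1) by (intro bexI[of _ b]) blast+
  qed auto
  then show ?thesis using that by blast
qed

text \<open>Types are finitely satisfiable sets that decide every formula; dropping the latter
  condition gives the sets to which Zorn's lemma is applied.\<close>

definition finsat where
  "finsat M X \<Gamma> \<longleftrightarrow> (\<forall>q\<subseteq>\<Gamma>. finite q \<longrightarrow> (\<exists>a\<in>tuples M X. \<forall>\<phi>\<in>q. sat M a \<phi>))"

text \<open>A maximal finitely satisfiable set decides every \<open>\<phi>\<close>: otherwise it has finite parts that
  exclude \<open>\<phi>\<close> and its negation, respectively, and no tuple satisfies both parts.\<close>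

lemma finsat_extends_to_type:
  assumes "\<Gamma> \<subseteq> forms L M X" "finsat M X \<Gamma>"
  obtains p where "p \<in> types L M X" "\<Gamma> \<subseteq> p"
proof -
  let ?A = "{S. \<Gamma> \<subseteq> S \<and> S \<subseteq> forms L M X \<and> finsat M X S}"
  have "\<exists>P\<in>?A. \<forall>S\<in>?A. P \<subseteq> S \<longrightarrow> S = P"
  proof (rule subset_Zorn_nonempty)
    show "?A \<noteq> {}" using assms by blast
    fix C assume C: "C \<noteq> {}" "subset.chain ?A C"
    then have CA: "C \<subseteq> ?A" by (simp add: subset.chain_def)
    have "finsat M X (\<Union>C)"
      unfolding finsat_def
    proof (intro allI impI)
      fix q assume q: "q \<subseteq> \<Union>C" "finite q"
      obtain S where "S \<in> C" "q \<subseteq> S"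
        using finite_subset_Union_chain[OF q(2,1) C] .
      then show "\<exists>a\<in>tuples M X. \<forall>\<phi>\<in>q. sat M a \<phi>"
        using CA q(2) by (auto simp: finsat_def)
    qed
    then show "\<Union>C \<in> ?A" using C(1) CA by blast
  qed
  then obtain P where PA: "P \<in> ?A" and max_A: "\<forall>S\<in>?A. P \<subseteq> S \<longrightarrow> S = P" by (elim bexE)
  then have P: "\<Gamma> \<subseteq> P" "P \<subseteq> forms L M X" "finsat M X P" by simp_all
  have max: "S = P" if "P \<subseteq> S" "S \<subseteq> forms L M X" "finsat M X S" for S
    using max_A[rule_format, of S] that order_trans[OF P(1) that(1)] by simp
  have conflict: "\<exists>q\<subseteq>P. finite q \<and> (\<forall>a\<in>tuples M X. (\<forall>\<psi>\<in>q. sat M a \<psi>) \<longrightarrow> \<not> sat M a \<phi>)"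
    if \<phi>: "\<phi> \<in> forms L M X" "\<phi> \<notin> P" for \<phi>
  proof -
    have "insert \<phi> P \<noteq> P" using \<phi>(2) by (metis insertI1)
    then have "\<not> finsat M X (insert \<phi> P)" using max[of "insert \<phi> P"] \<phi>(1) P(2) by auto
    then obtain q where q: "q \<subseteq> insert \<phi> P" "finite q" "\<not> (\<exists>a\<in>tuples M X. \<forall>\<psi>\<in>q. sat M a \<psi>)"
      unfolding finsat_def by meson
    show ?thesis
    proof (intro exI[of _ "q - {\<phi>}"] conjI ballI impI notI)
      fix a assume a: "a \<in> tuples M X" "\<forall>\<psi>\<in>q - {\<phi>}. sat M a \<psi>" "sat M a \<phi>"
      then have "\<forall>\<psi>\<in>q. sat M a \<psi>" by (metis Diff_iff singletonD)
      then show False using q(3) a(1) by blast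
    qed (use q in auto)
  qed
  have "\<phi> \<in> P \<or> Neg \<phi> \<in> P" if \<phi>: "\<phi> \<in> forms L M X" for \<phi>
  proof (rule ccontr)
    assume "\<not> (\<phi> \<in> P \<or> Neg \<phi> \<in> P)"
    then have "\<phi> \<notin> P" "Neg \<phi> \<notin> P" "Neg \<phi> \<in> forms L M X" using \<phi> by simp_all
    obtain q where q: "q \<subseteq> P" "finite q" "\<forall>a\<in>tuples M X. (\<forall>\<psi>\<in>q. sat M a \<psi>) \<longrightarrow> \<not> sat M a \<phi>"
      using conflict[OF \<phi> \<open>\<phi> \<notin> P\<close>] by meson
    obtain q' where q': "q' \<subseteq> P" "finite q'"
        "\<forall>a\<in>tuples M X. (\<forall>\<psi>\<in>q'. sat M a \<psi>) \<longrightarrow> \<not> sat M a (Neg \<phi>)"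
      using conflict[OF \<open>Neg \<phi> \<in> forms L M X\<close> \<open>Neg \<phi> \<notin> P\<close>] by meson
    have "finite (q \<union> q')" "q \<union> q' \<subseteq> P" using q q' by auto
    then obtain a where "a \<in> tuples M X" "\<forall>\<psi>\<in>q \<union> q'. sat M a \<psi>"
      using P(3) unfolding finsat_def by meson
    then show False using q(3) q'(3) by auto
  qed
  then have "P \<in> types L M X" using P by (auto simp: types_def finsat_def)
  then show ?thesis using P(1) that by blast
qed

text \<open>Given an open cover, let \<open>\<Psi>\<close> be the formulas whose clopen sets lie in a member of the
  cover.  A type containing all negations from \<open>\<Psi>\<close> would not be covered, so these negations are not
  finitely satisfiable, and a finite unsatisfiable part yields a finite subcover.\<close>

lemma compact_type_space: "compact_space (type_space L M X)"
  unfolding compact_space_alt topspace_type_space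
proof (intro allI impI, elim conjE)
  fix \<U> assume \<U>: "\<forall>U\<in>\<U>. openin (type_space L M X) U" "types L M X \<subseteq> \<Union>\<U>"
  define \<Psi> where "\<Psi> = {\<psi> \<in> forms L M X. \<exists>U\<in>\<U>. basic_clopen L M X \<psi> \<subseteq> U}"
  have cover: "\<exists>\<psi>\<in>\<Psi>. \<psi> \<in> p" if p: "p \<in> types L M X" for p
  proof -
    obtain U where U: "U \<in> \<U>" "p \<in> U" using \<U>(2) p by blast
    obtain \<psi> where "\<psi> \<in> forms L M X" "p \<in> basic_clopen L M X \<psi>" "basic_clopen L M X \<psi> \<subseteq> U"
      using clopen_base[OF _ U(2), of L M X] \<U>(1) U(1) by blast
    then show ?thesis using U(1) by (auto simp: \<Psi>_def basic_clopen_def)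
  qed
  have "\<not> finsat M X (Neg ` \<Psi>)"
  proof
    assume "finsat M X (Neg ` \<Psi>)"
    moreover have "Neg ` \<Psi> \<subseteq> forms L M X" by (auto simp: \<Psi>_def)
    ultimately obtain p where p: "p \<in> types L M X" "Neg ` \<Psi> \<subseteq> p"
      using finsat_extends_to_type by blast
    obtain \<psi> where "\<psi> \<in> \<Psi>" "\<psi> \<in> p" using cover[OF p(1)] by blast
    then show False using p type_Neg[OF p(1), of \<psi>] by (auto simp: \<Psi>_def)
  qed
  then obtain q where q: "q \<subseteq> Neg ` \<Psi>" "finite q" "\<not> (\<exists>a\<in>tuples M X. \<forall>\<phi>\<in>q. sat M a \<phi>)"
    unfolding finsat_def by blast
  then obtain \<Psi>' where \<Psi>': "\<Psi>' \<subseteq> \<Psi>" "finite \<Psi>'" "q = Neg ` \<Psi>'"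
    by (meson finite_subset_image)
  have "\<forall>\<psi>\<in>\<Psi>'. \<exists>U. U \<in> \<U> \<and> basic_clopen L M X \<psi> \<subseteq> U"
    using \<Psi>'(1) by (auto simp: \<Psi>_def)
  then obtain V where V: "\<And>\<psi>. \<psi> \<in> \<Psi>' \<Longrightarrow> V \<psi> \<in> \<U> \<and> basic_clopen L M X \<psi> \<subseteq> V \<psi>"
    by metis
  have "types L M X \<subseteq> \<Union>(V ` \<Psi>')"
  proof
    fix p assume p: "p \<in> types L M X"
    obtain a where a: "a \<in> tuples M X" "\<And>\<phi>. \<phi> \<in> \<Psi>' \<Longrightarrow> \<phi> \<in> p \<longleftrightarrow> sat M a \<phi>"
      using type_finitely_realized[OF p \<Psi>'(2)] \<Psi>'(1) by (auto simp: \<Psi>_def)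
    then obtain \<psi> where "\<psi> \<in> \<Psi>'" "\<psi> \<in> p" using q(3) \<Psi>'(3) by auto
    then show "p \<in> \<Union>(V ` \<Psi>')" using V p by (auto simp: basic_clopen_def)
  qed
  then show "\<exists>\<F>. finite \<F> \<and> \<F> \<subseteq> \<U> \<and> types L M X \<subseteq> \<Union>\<F>"
    using V \<Psi>'(2) by (intro exI[of _ "V ` \<Psi>'"]) auto
qed

section \<open>Borel extensions of Keisler measures\<close>

lemma keisler_solutions_cong:
  "\<nu> \<in> keisler L M X \<Longrightarrow> \<phi> \<in> forms L M X \<Longrightarrow> \<psi> \<in> forms L M X \<Longrightarrow>
    solutions M X \<phi> = solutions M X \<psi> \<Longrightarrow> \<nu> \<phi> = \<nu> \<psi>"
  unfolding keisler_def by blast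

lemma keisler_nonneg: "\<nu> \<in> keisler L M X \<Longrightarrow> \<phi> \<in> forms L M X \<Longrightarrow> 0 \<le> \<nu> \<phi>"
  unfolding keisler_def by blast

lemma keisler_total: "\<nu> \<in> keisler L M X \<Longrightarrow> \<nu> (Neg Fls) = 1"
  unfolding keisler_def by blast

lemma keisler_additive:
  "\<nu> \<in> keisler L M X \<Longrightarrow> \<phi> \<in> forms L M X \<Longrightarrow> \<psi> \<in> forms L M X \<Longrightarrow>
    solutions M X \<phi> \<inter> solutions M X \<psi> = {} \<Longrightarrow> \<nu> (Or \<phi> \<psi>) = \<nu> \<phi> + \<nu> \<psi>"
  unfolding keisler_def by blast

lemma keisler_cong:
  assumes \<nu>: "\<nu> \<in> keisler L M X" and \<phi>: "\<phi> \<in> forms L M X" "\<psi> \<in> forms L M X"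
    and eq: "basic_clopen L M X \<phi> = basic_clopen L M X \<psi>"
  shows "\<nu> \<phi> = \<nu> \<psi>"
proof -
  have "solutions M X \<phi> = solutions M X \<psi>"
    using \<phi> eq by (simp add: solutions_eq_basic_clopen[where L = L])
  then show ?thesis by (rule keisler_solutions_cong[OF \<nu> \<phi>])
qed

text \<open>A Keisler measure as a function of clopen sets; the choice of a formula is immaterial
  since formulas with the same clopen set have the same solutions.\<close>

definition clopen_value where
  "clopen_value L M X \<nu> b = ennreal (\<nu> (SOME \<psi>. \<psi> \<in> forms L M X \<and> basic_clopen L M X \<psi> = b))"

lemma clopen_value:
  assumes \<nu>: "\<nu> \<in> keisler L M X" and \<phi>: "\<phi> \<in> forms L M X"
  shows "clopen_value L M X \<nu> (basic_clopen L M X \<phi>) = ennreal (\<nu> \<phi>)"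
proof -
  let ?P = "\<lambda>\<psi>. \<psi> \<in> forms L M X \<and> basic_clopen L M X \<psi> = basic_clopen L M X \<phi>"
  have "?P (SOME \<psi>. ?P \<psi>)" by (rule someI[of ?P \<phi>]) (simp add: \<phi>)
  then have "\<nu> (SOME \<psi>. ?P \<psi>) = \<nu> \<phi>" using keisler_cong[OF \<nu> _ \<phi>] by blast
  then show ?thesis by (simp add: clopen_value_def)
qed

lemma clopen_content_keisler:
  assumes \<nu>: "\<nu> \<in> keisler L M X"
  shows "clopen_content (type_space L M X) (clopens L M X) (clopen_value L M X \<nu>)"
proof (rule clopen_content.intro)
  show "compact_space (type_space L M X)" by (rule compact_type_space)
  show "algebra (topspace (type_space L M X)) (clopens L M X)" by (simp add: algebra_clopens)
  show "openin (type_space L M X) b" if "b \<in> clopens L M X" for b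
    using that openin_clopen by (elim imageE) simp
  show "\<exists>b\<in>clopens L M X. p \<in> b \<and> b \<subseteq> U" if "openin (type_space L M X) U" "p \<in> U" for U p
    using clopen_base[OF that] by (metis image_eqI)
  have top: "topspace (type_space L M X) = basic_clopen L M X (Neg Fls)"
    by (simp add: basic_clopen_Neg basic_clopen_Fls)
  show "clopen_value L M X \<nu> (topspace (type_space L M X)) = 1"
    unfolding top using clopen_value[OF \<nu>, of "Neg Fls"] keisler_total[OF \<nu>] by simp
  fix b c assume "b \<in> clopens L M X" "c \<in> clopens L M X" and disj: "b \<inter> c = {}"
  then obtain \<phi> \<psi> where \<phi>: "\<phi> \<in> forms L M X" "b = basic_clopen L M X \<phi>"
    and \<psi>: "\<psi> \<in> forms L M X" "c = basic_clopen L M X \<psi>"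
    by (elim imageE)
  have "solutions M X \<phi> \<inter> solutions M X \<psi> = {}"
    using \<phi> \<psi> disj by (auto simp: solutions_eq_basic_clopen[where L = L])
  then have "\<nu> (Or \<phi> \<psi>) = \<nu> \<phi> + \<nu> \<psi>" "0 \<le> \<nu> \<phi>" "0 \<le> \<nu> \<psi>"
    using keisler_additive[OF \<nu> \<phi>(1) \<psi>(1)] keisler_nonneg[OF \<nu>] \<phi>(1) \<psi>(1) by simp_all
  moreover have "clopen_value L M X \<nu> (b \<union> c) = ennreal (\<nu> (Or \<phi> \<psi>))"
    using \<phi> \<psi> clopen_value[OF \<nu>, of "Or \<phi> \<psi>"] by (simp add: basic_clopen_Or)
  ultimately show "clopen_value L M X \<nu> (b \<union> c) = clopen_value L M X \<nu> b + clopen_value L M X \<nu> c"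
    using \<phi> \<psi> clopen_value[OF \<nu>] by simp
qed

text \<open>Existence by Caratheodory and uniqueness by regularity make the definite description that
  defines \<open>borel_extension\<close> a proper one.\<close>

lemma borel_extension:
  assumes \<nu>: "\<nu> \<in> keisler L M X"
  shows "regular_borel_prob (type_space L M X) (borel_extension L M X \<nu>)"
    and "\<psi> \<in> forms L M X \<Longrightarrow> measure (borel_extension L M X \<nu>) (basic_clopen L M X \<psi>) = \<nu> \<psi>"
proof -
  interpret clopen_content "type_space L M X" "clopens L M X" "clopen_value L M X \<nu>"
    by (rule clopen_content_keisler[OF \<nu>])
  let ?P = "\<lambda>N. regular_borel_prob (type_space L M X) N \<and>
    (\<forall>\<psi>\<in>forms L M X. measure N (basic_clopen L M X \<psi>) = \<nu> \<psi>)"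
  have "measure ext_measure (basic_clopen L M X \<psi>) = \<nu> \<psi>" if "\<psi> \<in> forms L M X" for \<psi>
    using emeasure_ext_clopen[OF imageI[OF that]] clopen_value[OF \<nu> that] keisler_nonneg[OF \<nu> that]
    by (simp add: measure_def)
  then have ex: "?P ext_measure" using regular_ext by simp
  have unique: "N = ext_measure" if N: "?P N" for N
  proof (rule regular_eqI)
    fix b assume "b \<in> clopens L M X"
    then obtain \<psi> where \<psi>: "\<psi> \<in> forms L M X" "b = basic_clopen L M X \<psi>" by (elim imageE)
    interpret N: prob_space N using N by (simp add: regular_borel_prob_def)
    interpret E: prob_space ext_measure by (rule prob_space_ext)
    show "emeasure N b = emeasure ext_measure b"
      using N ex \<psi> by (simp add: N.emeasure_eq_measure E.emeasure_eq_measure)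
  qed (use N ex in auto)
  have "?P (THE N. ?P N)" by (rule theI[of ?P, OF ex unique])
  then show "regular_borel_prob (type_space L M X) (borel_extension L M X \<nu>)"
    and "\<psi> \<in> forms L M X \<Longrightarrow> measure (borel_extension L M X \<nu>) (basic_clopen L M X \<psi>) = \<nu> \<psi>"
    unfolding borel_extension_def by simp_all
qed

section \<open>Fiber maps of definable measures\<close>

lemma fiber_map_continuous:
  "is_fiber_map L M Y \<mu> \<phi> F \<Longrightarrow> continuous_map (type_space L M Y) euclideanreal F"
  by (simp add: is_fiber_map_def continuous_map_in_subtopology)

text \<open>Realized types are dense: every nonempty clopen set contains the type of a tuple.\<close>

lemma is_fiber_map_unique:
  assumes F: "is_fiber_map L M Y \<mu> \<phi> F" and G: "is_fiber_map L M Y \<mu> \<phi> G"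
  shows "F = G"
proof (rule extensionalityI)
  show "F \<in> extensional (types L M Y)" "G \<in> extensional (types L M Y)"
    using F G by (simp_all add: is_fiber_map_def)
  fix p assume p: "p \<in> types L M Y"
  show "F p = G p"
  proof (rule ccontr)
    assume ne: "F p \<noteq> G p"
    let ?U = "{q \<in> topspace (type_space L M Y). F q - G q \<in> - {0}}"
    have "openin (type_space L M Y) ?U"
      by (rule openin_continuous_map_preimage[OF continuous_map_diff[OF
          fiber_map_continuous[OF F] fiber_map_continuous[OF G]]]) (simp add: open_Compl)
    moreover have "p \<in> ?U" using p ne by simp
    ultimately obtain \<psi> where \<psi>: "\<psi> \<in> forms L M Y" "p \<in> basic_clopen L M Y \<psi>" "basic_clopen L M Y \<psi> \<subseteq> ?U"
      by (rule clopen_base)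
    obtain b where b: "b \<in> tuples M Y" "sat M b \<psi>"
      using type_finitely_realized[OF p, of "{\<psi>}"] \<psi>(1,2) by (auto simp: basic_clopen_def)
    then have "tp L M Y b \<in> basic_clopen L M Y \<psi>"
      using \<psi>(1) by (simp add: basic_clopen_def tp_types in_tp)
    then have "tp L M Y b \<in> ?U" using \<psi>(3) by (rule rev_subsetD)
    moreover have "F (tp L M Y b) = \<mu> (inst Y b \<phi>)" "G (tp L M Y b) = \<mu> (inst Y b \<phi>)"
      using F G b(1) unfolding is_fiber_map_def by blast+
    ultimately show False by simp
  qed
qed

text \<open>Naming the tuple \<open>c\<close> turns a type in \<open>y\<close> into a type in \<open>yz\<close>; on types of tuples this is
  \<open>tp(b) \<mapsto> tp(b,c)\<close>.\<close>

lemma type_restriction: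
  assumes p: "p \<in> types L M Y" and c: "c \<in> tuples M Z"
  shows "{\<psi> \<in> forms L M (Y \<union> Z). inst Z c \<psi> \<in> p} \<in> types L M (Y \<union> Z)"
    (is "?g \<in> _")
  unfolding types_def
proof (intro CollectI conjI allI ballI impI)
  show "?g \<subseteq> forms L M (Y \<union> Z)" by simp
next
  fix q assume q: "q \<subseteq> ?g" "finite q"
  have "inst Z c ` q \<subseteq> p" using q(1) by auto
  moreover have "finite (inst Z c ` q)" using q(2) by simp
  ultimately obtain a where a: "a \<in> tuples M Y" "\<forall>\<phi>\<in>inst Z c ` q. sat M a \<phi>"
    using p unfolding types_def mem_Collect_eq by meson
  then show "\<exists>a\<in>tuples M (Y \<union> Z). \<forall>\<phi>\<in>q. sat M a \<phi>"
    using override_tuples[OF a(1) c] by (intro bexI[of _ "override_on a c Z"]) (auto simp: sat_inst)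
next
  fix \<psi> assume \<psi>: "\<psi> \<in> forms L M (Y \<union> Z)"
  then have "inst Z c \<psi> \<in> forms L M Y" using inst_forms[OF _ order_refl c] by blast
  then show "\<psi> \<in> ?g \<or> Neg \<psi> \<in> ?g" using \<psi> type_Neg[OF p] by auto
qed

text \<open>For \<open>\<phi>(x,y) = \<phi>\<^sub>0(x,y,c)\<close> the fiber map is that of \<open>\<phi>\<^sub>0(x,yz)\<close> composed with the
  continuous map of \<open>type_restriction\<close>.\<close>

lemma definable_fiber_map:
  assumes def: "definable L M X \<mu>" and fin: "finite X" "finite Y" and disj: "X \<inter> Y = {}"
    and \<phi>: "\<phi> \<in> forms L M (X \<union> Y)"
  shows "is_fiber_map L M Y \<mu> \<phi> (fiber_map L M Y \<mu> \<phi>)"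
proof -
  obtain Z c \<phi>0 where Z: "finite Z" "Z \<inter> (X \<union> Y) = {}" and c: "c \<in> tuples M Z"
    and \<phi>0: "\<phi>0 \<in> forms L M ((X \<union> Y) \<union> Z)" "params \<phi>0 = {}" "inst Z c \<phi>0 = \<phi>"
    using forms_parameter_free[OF \<phi>, of "X \<union> Y"] fin by blast
  have "finite (Y \<union> Z)" "X \<inter> (Y \<union> Z) = {}" using fin Z disj by auto
  then obtain F where F: "is_fiber_map L M (Y \<union> Z) \<mu> \<phi>0 F"
    using def \<phi>0(1,2) unfolding definable_def Un_assoc by meson
  define g where "g p = {\<psi> \<in> forms L M (Y \<union> Z). inst Z c \<psi> \<in> p}" for p
  have inst_Y: "inst Z c \<psi> \<in> forms L M Y" if "\<psi> \<in> forms L M (Y \<union> Z)" for \<psi>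
    using inst_forms[OF that order_refl c] .
  have g: "g p \<in> types L M (Y \<union> Z)" if "p \<in> types L M Y" for p
    unfolding g_def using that c by (rule type_restriction)
  have cont_g: "continuous_map (type_space L M Y) (type_space L M (Y \<union> Z)) g"
    unfolding type_space_def[of L M "Y \<union> Z"]
  proof (rule continuous_on_generated_topo)
    fix U assume "U \<in> clopens L M (Y \<union> Z)"
    then obtain \<psi> where \<psi>: "\<psi> \<in> forms L M (Y \<union> Z)" "U = basic_clopen L M (Y \<union> Z) \<psi>"
      by (elim imageE)
    have "g -` U \<inter> topspace (type_space L M Y) = basic_clopen L M Y (inst Z c \<psi>)"
      using g \<psi> by (auto simp: basic_clopen_def) (auto simp: g_def)
    then show "openin (type_space L M Y) (g -` U \<inter> topspace (type_space L M Y))"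
      using openin_clopen[OF inst_Y[OF \<psi>(1)]] by simp
  next
    have "\<Union>(clopens L M (Y \<union> Z)) = types L M (Y \<union> Z)"
      using topspace_type_space[of L M "Y \<union> Z"]
      unfolding type_space_def topology_generated_by_topspace .
    then show "g ` topspace (type_space L M Y) \<subseteq> \<Union>(clopens L M (Y \<union> Z))"
      using g by auto
  qed
  have g_tp: "g (tp L M Y b) = tp L M (Y \<union> Z) (override_on b c Z)" if "b \<in> tuples M Y" for b
    using inst_Y by (auto simp: g_def tp_def sat_inst)
  have fib: "is_fiber_map L M Y \<mu> \<phi> (restrict (F \<circ> g) (types L M Y))"
    unfolding is_fiber_map_def
  proof (intro conjI ballI)
    have "continuous_map (type_space L M Y) (top_of_set {0..1}) (F \<circ> g)"
      using F by (intro continuous_map_compose[OF cont_g]) (simp add: is_fiber_map_def)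
    then show "continuous_map (type_space L M Y) (top_of_set {0..1}) (restrict (F \<circ> g) (types L M Y))"
      by (rule continuous_map_eq) simp
    fix b assume b: "b \<in> tuples M Y"
    have "inst Y b \<phi> = inst (Y \<union> Z) (override_on b c Z) \<phi>0"
      unfolding \<phi>0(3)[symmetric] by (rule inst_inst) auto
    moreover have "F (tp L M (Y \<union> Z) (override_on b c Z)) = \<mu> (inst (Y \<union> Z) (override_on b c Z) \<phi>0)"
      using F override_tuples[OF b c] unfolding is_fiber_map_def by blast
    ultimately show "restrict (F \<circ> g) (types L M Y) (tp L M Y b) = \<mu> (inst Y b \<phi>)"
      using b by (simp add: tp_types g_tp)
  qed simp
  have "\<exists>!F. is_fiber_map L M Y \<mu> \<phi> F"
  proof (rule ex1I)
    show "is_fiber_map L M Y \<mu> \<phi> (restrict (F \<circ> g) (types L M Y))" by (rule fib)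
  qed (rule is_fiber_map_unique[OF _ fib])
  then show ?thesis unfolding fiber_map_def by (rule theI')
qed

section \<open>Step functions on type spaces\<close>

text \<open>The invariant of the induction below: the step function with values \<open>c\<close> on the sets \<open>\<theta>\<close>
  approximates \<open>F\<close> on the union \<open>\<rho>\<close> of the cover \<open>Q\<close> and vanishes outside it.  Indexing the steps by
  \<open>Q\<close> itself keeps one step for each member of the cover.\<close>

definition step_on where
  "step_on L M Y F \<epsilon> Q \<rho> c \<theta> \<longleftrightarrow>
    \<rho> \<in> forms L M Y \<and> basic_clopen L M Y \<rho> = (\<Union>\<psi>\<in>Q. basic_clopen L M Y \<psi>) \<and>
    (\<forall>\<psi>\<in>Q. \<theta> \<psi> \<in> forms L M Y) \<and>
    (\<forall>p\<in>types L M Y. \<rho> \<notin> p \<longrightarrow> (\<forall>\<psi>\<in>Q. \<theta> \<psi> \<notin> p)) \<and>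
    (\<forall>p\<in>types L M Y. \<rho> \<in> p \<longrightarrow> \<bar>F p - (\<Sum>\<psi>\<in>Q. c \<psi> * of_bool (\<theta> \<psi> \<in> p))\<bar> \<le> (\<epsilon> :: real))"

text \<open>A further clopen set contributes a step on the part of it that the previous ones miss, so
  that the steps are disjoint.\<close>

lemma step_approximation_on_cover:
  fixes F :: "('f, 'r, 'a) fm set \<Rightarrow> real"
  assumes "finite Q" "Q \<subseteq> forms L M Y"
    and "\<And>\<psi>. \<psi> \<in> Q \<Longrightarrow> \<exists>r. \<forall>p\<in>basic_clopen L M Y \<psi>. \<bar>F p - r\<bar> \<le> \<epsilon>"
  shows "\<exists>\<rho> c \<theta>. step_on L M Y F \<epsilon> Q \<rho> c \<theta>"
  using assms
proof (induction Q)
  case empty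
  have "step_on L M Y F \<epsilon> {} Fls c \<theta>" for c \<theta>
    by (simp add: step_on_def basic_clopen_Fls type_Fls)
  then show ?case by blast
next
  case (insert \<psi> Q)
  have "\<exists>\<rho> c \<theta>. step_on L M Y F \<epsilon> Q \<rho> c \<theta>"
    by (rule insert.IH) (use insert.prems in auto)
  then obtain \<rho> c \<theta> where st: "step_on L M Y F \<epsilon> Q \<rho> c \<theta>" by (elim exE)
  then have \<rho>: "\<rho> \<in> forms L M Y" "basic_clopen L M Y \<rho> = (\<Union>\<psi>\<in>Q. basic_clopen L M Y \<psi>)"
    and \<theta>: "\<forall>\<psi>\<in>Q. \<theta> \<psi> \<in> forms L M Y"
    by (simp_all add: step_on_def)
  have off: "\<theta> \<psi> \<notin> p" if "p \<in> types L M Y" "\<rho> \<notin> p" "\<psi> \<in> Q" for p \<psi>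
    using st that unfolding step_on_def by blast
  have on: "\<bar>F p - (\<Sum>\<psi>\<in>Q. c \<psi> * of_bool (\<theta> \<psi> \<in> p))\<bar> \<le> \<epsilon>"
    if "p \<in> types L M Y" "\<rho> \<in> p" for p
    using st that unfolding step_on_def by blast
  obtain r where r: "\<And>p. p \<in> basic_clopen L M Y \<psi> \<Longrightarrow> \<bar>F p - r\<bar> \<le> \<epsilon>"
    using insert.prems(2)[of \<psi>] by auto
  have \<psi>: "\<psi> \<in> forms L M Y" using insert.prems(1) by simp
  let ?new = "Neg (Or (Neg \<psi>) \<rho>)"
  let ?c = "c(\<psi> := r)" and ?\<theta> = "\<theta>(\<psi> := ?new)"
  have new: "?new \<in> p \<longleftrightarrow> \<psi> \<in> p \<and> \<rho> \<notin> p" if "p \<in> types L M Y" for p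
    using that \<psi> \<rho>(1) by (simp add: type_Neg type_Or)
  have sum_eq: "(\<Sum>\<psi>'\<in>insert \<psi> Q. ?c \<psi>' * of_bool (?\<theta> \<psi>' \<in> p))
      = r * of_bool (?new \<in> p) + (\<Sum>\<psi>'\<in>Q. c \<psi>' * of_bool (\<theta> \<psi>' \<in> p))" for p
  proof -
    have "(\<Sum>\<psi>'\<in>Q. ?c \<psi>' * of_bool (?\<theta> \<psi>' \<in> p)) = (\<Sum>\<psi>'\<in>Q. c \<psi>' * of_bool (\<theta> \<psi>' \<in> p))"
      using insert.hyps(2) by (intro sum.cong) auto
    then show ?thesis by (simp only: sum.insert[OF insert.hyps] fun_upd_same)
  qed
  have "step_on L M Y F \<epsilon> (insert \<psi> Q) (Or \<psi> \<rho>) ?c ?\<theta>"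
    unfolding step_on_def
  proof (intro conjI ballI impI)
    show "basic_clopen L M Y (Or \<psi> \<rho>) = (\<Union>\<psi>\<in>insert \<psi> Q. basic_clopen L M Y \<psi>)"
      using \<psi> \<rho> by (simp add: basic_clopen_Or)
    show "?\<theta> \<psi>' \<in> forms L M Y" if "\<psi>' \<in> insert \<psi> Q" for \<psi>'
      using that \<theta> \<psi> \<rho>(1) by auto
    show "Or \<psi> \<rho> \<in> forms L M Y" using \<psi> \<rho>(1) by simp
    show "?\<theta> \<psi>' \<notin> p" if p: "p \<in> types L M Y" and "Or \<psi> \<rho> \<notin> p" and "\<psi>' \<in> insert \<psi> Q" for p \<psi>'
    proof -
      have "\<psi> \<notin> p" "\<rho> \<notin> p" using type_Or[OF p \<psi> \<rho>(1)] \<open>Or \<psi> \<rho> \<notin> p\<close> by auto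
      then show ?thesis using off[OF p] new[OF p] \<open>\<psi>' \<in> insert \<psi> Q\<close> by auto
    qed
    show "\<bar>F p - (\<Sum>\<psi>'\<in>insert \<psi> Q. ?c \<psi>' * of_bool (?\<theta> \<psi>' \<in> p))\<bar> \<le> \<epsilon>"
      if p: "p \<in> types L M Y" and "Or \<psi> \<rho> \<in> p" for p
    proof (cases "\<rho> \<in> p")
      case True
      then show ?thesis using on[OF p True] new[OF p] unfolding sum_eq by simp
    next
      case False
      then have "\<psi> \<in> p" using type_Or[OF p \<psi> \<rho>(1)] \<open>Or \<psi> \<rho> \<in> p\<close> by auto
      moreover have "(\<Sum>\<psi>'\<in>Q. c \<psi>' * of_bool (\<theta> \<psi>' \<in> p)) = 0"
        using off[OF p False] by (intro sum.neutral) auto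
      ultimately show ?thesis
        using False new[OF p] r[of p] p unfolding sum_eq by (simp add: basic_clopen_def)
    qed
  qed
  then show ?case by (intro exI)
qed

lemma step_approximation:
  fixes F :: "('f, 'r, 'a) fm set \<Rightarrow> real"
  assumes F: "continuous_map (type_space L M Y) euclideanreal F" and \<epsilon>: "\<epsilon> > 0"
  obtains Q :: "('f, 'r, 'a) fm set" and c \<theta> where "finite Q" "\<And>\<psi>. \<psi> \<in> Q \<Longrightarrow> \<theta> \<psi> \<in> forms L M Y"
    "\<And>p. p \<in> types L M Y \<Longrightarrow> \<bar>F p - (\<Sum>\<psi>\<in>Q. c \<psi> * of_bool (\<theta> \<psi> \<in> p))\<bar> \<le> \<epsilon>"
proof -
  let ?small = "\<lambda>\<psi>. \<exists>r. \<forall>p\<in>basic_clopen L M Y \<psi>. \<bar>F p - r\<bar> \<le> \<epsilon>"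
  let ?\<Psi> = "{\<psi> \<in> forms L M Y. ?small \<psi>}"
  have cover: "\<exists>\<psi>\<in>?\<Psi>. p \<in> basic_clopen L M Y \<psi>" if p: "p \<in> types L M Y" for p
  proof -
    let ?U = "{q \<in> topspace (type_space L M Y). F q \<in> ball (F p) \<epsilon>}"
    have "openin (type_space L M Y) ?U"
      by (rule openin_continuous_map_preimage[OF F]) simp
    moreover have "p \<in> ?U" using p \<epsilon> by simp
    ultimately obtain \<psi> where \<psi>: "\<psi> \<in> forms L M Y" "p \<in> basic_clopen L M Y \<psi>" "basic_clopen L M Y \<psi> \<subseteq> ?U"
      by (rule clopen_base)
    have "\<forall>q\<in>basic_clopen L M Y \<psi>. \<bar>F q - F p\<bar> \<le> \<epsilon>"
      using \<psi>(3) by (force simp: dist_real_def)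
    then show ?thesis using \<psi>(1,2) by auto
  qed
  have "compactin (type_space L M Y) (types L M Y)"
    using compact_type_space[of L M Y] by (simp add: compact_space_def)
  moreover have "types L M Y \<subseteq> \<Union>(basic_clopen L M Y ` ?\<Psi>)" using cover by auto
  moreover have "openin (type_space L M Y) U" if "U \<in> basic_clopen L M Y ` ?\<Psi>" for U
    using that by (auto intro: openin_clopen)
  ultimately have "\<exists>B. finite B \<and> B \<subseteq> basic_clopen L M Y ` ?\<Psi> \<and> types L M Y \<subseteq> \<Union>B"
    by (intro compactinD)
  then obtain B where B: "finite B" "B \<subseteq> basic_clopen L M Y ` ?\<Psi>" "types L M Y \<subseteq> \<Union>B"
    by (elim exE conjE)
  obtain Q where Q: "Q \<subseteq> ?\<Psi>" "finite Q" "B = basic_clopen L M Y ` Q"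
    using finite_subset_image[OF B(1,2)] by (elim exE conjE)
  have "Q \<subseteq> forms L M Y" "\<And>\<psi>. \<psi> \<in> Q \<Longrightarrow> ?small \<psi>" using Q(1) by auto
  then obtain \<rho> c \<theta> where st: "step_on L M Y F \<epsilon> Q \<rho> c \<theta>"
    using step_approximation_on_cover[OF Q(2), of L M Y F \<epsilon>] by metis
  then have "basic_clopen L M Y \<rho> = types L M Y"
    using B(3) Q(3) by (auto simp: step_on_def basic_clopen_def)
  then have \<rho>: "\<rho> \<in> p" if "p \<in> types L M Y" for p
    using that unfolding basic_clopen_def by blast
  show ?thesis
  proof (rule that[OF Q(2)])
    show "\<theta> \<psi> \<in> forms L M Y" if "\<psi> \<in> Q" for \<psi>
      using st that by (simp add: step_on_def)
    show "\<bar>F p - (\<Sum>\<psi>\<in>Q. c \<psi> * of_bool (\<theta> \<psi> \<in> p))\<bar> \<le> \<epsilon>" if "p \<in> types L M Y" for p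
      using st \<rho>[OF that] that unfolding step_on_def by blast
  qed
qed

text \<open>As the bound holds at every type, it survives integration against a probability measure;
  the integral of the step function is computed from the values of \<open>\<nu>\<close>.\<close>

lemma integral_step_approximation:
  fixes F :: "('f, 'r, 'a) fm set \<Rightarrow> real"
  assumes \<nu>: "\<nu> \<in> keisler L M Y" and F: "continuous_map (type_space L M Y) euclideanreal F"
    and J: "finite J" "\<And>j. j \<in> J \<Longrightarrow> \<theta> j \<in> forms L M Y"
    and approx: "\<And>p. p \<in> types L M Y \<Longrightarrow> \<bar>F p - (\<Sum>j\<in>J. c j * of_bool (\<theta> j \<in> p))\<bar> \<le> \<epsilon>"
  shows "\<bar>(\<integral>p. F p \<partial>borel_extension L M Y \<nu>) - (\<Sum>j\<in>J. c j * \<nu> (\<theta> j))\<bar> \<le> \<epsilon>"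
proof -
  let ?N = "borel_extension L M Y \<nu>"
  note reg = borel_extension(1)[OF \<nu>]
  interpret N: prob_space ?N using reg by (simp add: regular_borel_prob_def)
  have sets_N: "sets ?N = sigma_sets (types L M Y) {U. openin (type_space L M Y) U}"
    using reg by (simp add: regular_borel_prob_def)
  have openN: "U \<in> sets ?N" if "openin (type_space L M Y) U" for U
    using that unfolding sets_N by auto
  have "{U. openin (type_space L M Y) U} \<subseteq> Pow (types L M Y)"
    by (auto dest!: openin_subset)
  then have "sets ?N = sets (sigma (types L M Y) {U. openin (type_space L M Y) U})"
    "space (sigma (types L M Y) {U. openin (type_space L M Y) U}) = types L M Y"
    by (simp_all add: sets_N)
  then have space_N: "space ?N = types L M Y" by (metis sets_eq_imp_space_eq)
  let ?G = "\<lambda>p. \<Sum>j\<in>J. c j * indicator (basic_clopen L M Y (\<theta> j)) p"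
  have G: "?G p = (\<Sum>j\<in>J. c j * of_bool (\<theta> j \<in> p))" if "p \<in> types L M Y" for p
    using that by (intro sum.cong) (auto simp: basic_clopen_def indicator_def)
  have F_meas: "F \<in> borel_measurable ?N"
  proof (rule borel_measurableI)
    fix S :: "real set" assume "open S"
    then have "openin (type_space L M Y) {p \<in> topspace (type_space L M Y). F p \<in> S}"
      using openin_continuous_map_preimage[OF F] by simp
    moreover have "F -` S \<inter> space ?N = {p \<in> topspace (type_space L M Y). F p \<in> S}"
      by (auto simp: space_N)
    ultimately show "F -` S \<inter> space ?N \<in> sets ?N" using openN by simp
  qed
  have int_ind: "integrable ?N (\<lambda>p. c j * indicator (basic_clopen L M Y (\<theta> j)) p)"
    and meas: "basic_clopen L M Y (\<theta> j) \<in> sets ?N" if "j \<in> J" for j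
  proof -
    show meas: "basic_clopen L M Y (\<theta> j) \<in> sets ?N"
      by (rule openN[OF openin_clopen[OF J(2)[OF that]]])
    show "integrable ?N (\<lambda>p. c j * indicator (basic_clopen L M Y (\<theta> j)) p)"
      by (intro integrable_mult_right integrable_real_indicator meas) (simp add: N.emeasure_eq_measure)
  qed
  then have int_G: "integrable ?N ?G" by (intro Bochner_Integration.integrable_sum)
  have int_FG: "integrable ?N (\<lambda>p. F p - ?G p)"
  proof (rule N.integrable_const_bound[where B = \<epsilon>])
    show "AE p in ?N. norm (F p - ?G p) \<le> \<epsilon>"
      using approx G by (intro AE_I2) (simp add: space_N)
    show "(\<lambda>p. F p - ?G p) \<in> borel_measurable ?N"
      using F_meas int_G by (intro borel_measurable_diff) auto
  qed
  have int_F: "integrable ?N F"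
    using Bochner_Integration.integrable_add[OF int_FG int_G] by simp
  have "(\<integral>p. ?G p \<partial>?N) = (\<Sum>j\<in>J. \<integral>p. c j * indicator (basic_clopen L M Y (\<theta> j)) p \<partial>?N)"
    using int_ind by (rule Bochner_Integration.integral_sum)
  also have "\<dots> = (\<Sum>j\<in>J. c j * measure ?N (basic_clopen L M Y (\<theta> j)))"
    using meas by (intro sum.cong) (simp_all add: Int_absorb2 sets.sets_into_space)
  also have "\<dots> = (\<Sum>j\<in>J. c j * \<nu> (\<theta> j))"
    by (intro sum.cong refl) (simp only: borel_extension(2)[OF \<nu> J(2)])
  finally have "(\<integral>p. F p \<partial>?N) - (\<Sum>j\<in>J. c j * \<nu> (\<theta> j)) = (\<integral>p. F p - ?G p \<partial>?N)"
    using int_F int_G by simp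
  also have "\<bar>\<dots>\<bar> \<le> (\<integral>p. \<bar>F p - ?G p\<bar> \<partial>?N)" by (rule integral_abs_bound)
  also have "\<dots> \<le> \<epsilon>"
    using approx G int_FG by (intro N.integral_le_const integrable_abs AE_I2) (simp_all add: space_N)
  finally show ?thesis .
qed

section \<open>The theorem of Los\<close>

lemma eval_in_univ:
  assumes "is_struct L N" "wf_tm L t" "params_tm t \<subseteq> univ N" "\<And>v. v \<in> fv_tm t \<Longrightarrow> e v \<in> univ N"
  shows "eval_tm N e t \<in> univ N"
  using assms(2-4)
proof (induction t)
  case (Fn f ts)
  have "eval_tm N e t \<in> univ N" if "t \<in> set ts" for t
    by (rule Fn.IH[OF that]) (use Fn.prems that in \<open>auto simp: list_all_iff\<close>)
  then have "set (map (eval_tm N e) ts) \<subseteq> univ N" by auto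
  then show ?case using assms(1) Fn.prems(1) by (simp add: is_struct_def)
qed auto

lemma ultrafilter_not:
  assumes "ultrafilter D"
  shows "eventually (\<lambda>i. \<not> P i) D \<longleftrightarrow> \<not> eventually P D"
proof
  assume "eventually (\<lambda>i. \<not> P i) D"
  moreover have "eventually (\<lambda>i. False) D" if "eventually P D" "eventually (\<lambda>i. \<not> P i) D"
    using eventually_conj[OF that] by simp
  ultimately show "\<not> eventually P D"
    using assms by (auto simp: ultrafilter_def trivial_limit_def)
next
  assume "\<not> eventually P D"
  then show "eventually (\<lambda>i. \<not> P i) D" using assms unfolding ultrafilter_def by blast
qed

lemma ultrafilter_or:
  assumes D: "ultrafilter D"
  shows "eventually (\<lambda>i. P i \<or> Q i) D \<longleftrightarrow> eventually P D \<or> eventually Q D"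
proof
  assume PQ: "eventually (\<lambda>i. P i \<or> Q i) D"
  show "eventually P D \<or> eventually Q D"
  proof (cases "eventually P D")
    case False
    then have "eventually (\<lambda>i. \<not> P i) D" using ultrafilter_not[OF D] by blast
    with PQ have "eventually Q D" by eventually_elim simp
    then show ?thesis ..
  qed simp
next
  assume "eventually P D \<or> eventually Q D"
  then show "eventually (\<lambda>i. P i \<or> Q i) D"
    by (auto elim: eventually_mono)
qed

text \<open>\<open>Lim\<close> is a definite description, meaningful here because the image of an ultrafilter in
  a compact interval clusters at a point and, being an ultrafilter, converges to it.\<close>

lemma ultrafilter_bounded_tendsto_Lim:
  fixes f :: "'i \<Rightarrow> real"
  assumes D: "ultrafilter D" and B: "\<And>i. \<bar>f i\<bar> \<le> B"
  shows "(f \<longlongrightarrow> Lim D f) D"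
proof -
  have nt: "D \<noteq> bot" using D by (simp add: ultrafilter_def)
  have "filtermap f D \<noteq> bot" using nt by (simp add: filtermap_bot_iff)
  moreover have "eventually (\<lambda>x. x \<in> {-B..B}) (filtermap f D)"
    using B by (auto simp: eventually_filtermap abs_le_iff minus_le_iff intro!: always_eventually)
  ultimately obtain l where l: "inf (nhds l) (filtermap f D) \<noteq> bot"
    using compact_Icc[of "-B" B] unfolding compact_filter by blast
  have "(f \<longlongrightarrow> l) D"
  proof (rule topological_tendstoI)
    fix S :: "real set" assume S: "open S" "l \<in> S"
    show "eventually (\<lambda>i. f i \<in> S) D"
    proof (rule ccontr)
      assume "\<not> eventually (\<lambda>i. f i \<in> S) D"
      then have "eventually (\<lambda>i. f i \<notin> S) D" using ultrafilter_not[OF D] by blast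
      then have "eventually (\<lambda>x. x \<notin> S) (filtermap f D)" by (simp add: eventually_filtermap)
      moreover have "eventually (\<lambda>x. x \<in> S) (nhds l)" using S by (rule eventually_nhds_in_open)
      ultimately have "eventually (\<lambda>x. False) (inf (nhds l) (filtermap f D))"
        unfolding eventually_inf by (intro exI[of _ "\<lambda>x. x \<in> S"] exI[of _ "\<lambda>x. x \<notin> S"]) auto
      then show False using l by (simp add: trivial_limit_def)
    qed
  qed
  then show ?thesis using tendsto_Lim[OF nt] by metis
qed

locale ultraproduct_structs =
  fixes L :: "('f, 'r) lang" and M :: "'i \<Rightarrow> ('f, 'r, 'a) struct" and D :: "'i filter"
  assumes D: "ultrafilter D" and struct: "\<And>i. is_struct L (M i)"
begin

abbreviation U where "U \<equiv> ultraproduct D M"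

definition cls :: "('i \<Rightarrow> 'a) \<Rightarrow> ('i \<Rightarrow> 'a) set" where
  "cls f = ae_eq D M `` {f}"

lemma D_nontrivial: "D \<noteq> bot"
  using D by (simp add: ultrafilter_def)

lemma univ_U: "univ U = cls ` {f. \<forall>i. f i \<in> univ (M i)}"
  by (auto simp: ultraproduct_def quotient_def cls_def)

lemma in_cls:
  "g \<in> cls f \<longleftrightarrow> (\<forall>i. f i \<in> univ (M i)) \<and> (\<forall>i. g i \<in> univ (M i)) \<and> eventually (\<lambda>i. f i = g i) D"
  by (simp add: cls_def ae_eq_def)

lemma cls_univ: "(\<And>i. f i \<in> univ (M i)) \<Longrightarrow> cls f \<in> univ U"
  by (simp add: univ_U)

lemma rep_cls_mem:
  assumes "\<And>i. f i \<in> univ (M i)" shows "rep (cls f) \<in> cls f"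
  unfolding rep_def by (rule someI[of "\<lambda>g. g \<in> cls f" f]) (use assms in \<open>simp add: in_cls\<close>)

lemma rep_cls: "(\<And>i. f i \<in> univ (M i)) \<Longrightarrow> eventually (\<lambda>i. rep (cls f) i = f i) D"
  using rep_cls_mem[of f] by (auto simp: in_cls elim: eventually_mono)

lemma rep_univ:
  assumes "b \<in> univ U" shows "rep b i \<in> univ (M i)"
proof -
  obtain f where "b = cls f" "\<And>i. f i \<in> univ (M i)" using assms univ_U by auto
  then show ?thesis using rep_cls_mem[of f] by (simp add: in_cls)
qed

lemma cls_cong:
  assumes "\<And>i. f i \<in> univ (M i)" "\<And>i. g i \<in> univ (M i)" "eventually (\<lambda>i. f i = g i) D"
  shows "cls f = cls g"
proof (rule set_eqI)
  fix h
  have "eventually (\<lambda>i. f i = h i) D \<longleftrightarrow> eventually (\<lambda>i. g i = h i) D"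
    using assms(3) by (rule eventually_cong) auto
  then show "h \<in> cls f \<longleftrightarrow> h \<in> cls g" using assms(1,2) by (simp add: in_cls)
qed

lemma cls_rep:
  assumes "b \<in> univ U" shows "cls (rep b) = b"
proof -
  obtain f where f: "b = cls f" "\<And>i. f i \<in> univ (M i)" using assms univ_U by auto
  have "cls (rep b) = cls f"
    by (rule cls_cong) (use rep_univ[OF assms] f rep_cls in auto)
  then show ?thesis using f by simp
qed

lemma eq_iff_rep:
  assumes "b \<in> univ U" "c \<in> univ U"
  shows "b = c \<longleftrightarrow> eventually (\<lambda>i. rep b i = rep c i) D"
  using cls_cong[OF rep_univ[OF assms(1)] rep_univ[OF assms(2)]] cls_rep assms by auto

lemma finterp_U: "finterp U f bs = cls (\<lambda>i. finterp (M i) f (map (\<lambda>b. rep b i) bs))"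
  by (simp add: ultraproduct_def cls_def)

lemma finterp_rep_univ:
  assumes "f \<in> funs L" "length bs = farity L f" "set bs \<subseteq> univ U"
  shows "finterp (M i) f (map (\<lambda>b. rep b i) bs) \<in> univ (M i)"
proof -
  have "set (map (\<lambda>b. rep b i) bs) \<subseteq> univ (M i)" using assms(3) rep_univ by auto
  then show ?thesis using struct[of i] assms(1,2) by (simp add: is_struct_def)
qed

lemma is_struct_U: "is_struct L U"
  unfolding is_struct_def
proof (intro conjI ballI allI impI)
  have "(SOME a. a \<in> univ (M i)) \<in> univ (M i)" for i
    using struct[of i] by (simp add: is_struct_def some_in_eq)
  then show "univ U \<noteq> {}" using cls_univ[of "\<lambda>i. SOME a. a \<in> univ (M i)"] by auto
  show "finterp U f bs \<in> univ U" if "f \<in> funs L" "length bs = farity L f \<and> set bs \<subseteq> univ U" for f bs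
    unfolding finterp_U by (rule cls_univ) (use that finterp_rep_univ in blast)
qed

lemma los_tm:
  assumes "wf_tm L t" "params_tm t \<subseteq> univ U" "\<And>v. v \<in> fv_tm t \<Longrightarrow> e v \<in> univ U"
  shows "eventually (\<lambda>i. rep (eval_tm U e t) i =
    eval_tm (M i) (\<lambda>v. rep (e v) i) (map_tm (\<lambda>b. rep b i) t)) D"
  using assms
proof (induction t)
  case (Fn f ts)
  let ?bs = "map (eval_tm U e) ts"
  have ts: "wf_tm L t" "params_tm t \<subseteq> univ U" "\<And>v. v \<in> fv_tm t \<Longrightarrow> e v \<in> univ U" if "t \<in> set ts" for t
    using Fn.prems that by (auto simp: list_all_iff)
  have "set ?bs \<subseteq> univ U" using eval_in_univ[OF is_struct_U] ts by auto
  then have "finterp (M i) f (map (\<lambda>b. rep b i) ?bs) \<in> univ (M i)" for i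
    using Fn.prems(1) by (intro finterp_rep_univ) auto
  then have "eventually (\<lambda>i. rep (eval_tm U e (Fn f ts)) i = finterp (M i) f (map (\<lambda>b. rep b i) ?bs)) D"
    unfolding eval_tm.simps finterp_U by (rule rep_cls)
  moreover have "eventually (\<lambda>i. \<forall>t\<in>set ts. rep (eval_tm U e t) i =
      eval_tm (M i) (\<lambda>v. rep (e v) i) (map_tm (\<lambda>b. rep b i) t)) D"
    using Fn.IH ts by (intro eventually_ball_finite) auto
  ultimately show ?case
  proof eventually_elim
    case (elim i)
    then have "map (\<lambda>b. rep b i) ?bs =
        map (eval_tm (M i) (\<lambda>v. rep (e v) i)) (map (map_tm (\<lambda>b. rep b i)) ts)"
      by simp
    then show ?case using elim(1) by (simp only: tm.map eval_tm.simps)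
  qed
qed simp_all

text \<open>Valuations are only required to be proper on the free variables, since tuples are
  undefined elsewhere.  In the existential step, witnesses chosen in each \<open>M\<^sub>i\<close> form a
  witness in the ultraproduct.\<close>

theorem los:
  assumes "wf_fm L \<phi>" "params \<phi> \<subseteq> univ U" "\<And>v. v \<in> fv \<phi> \<Longrightarrow> e v \<in> univ U"
  shows "sat U e \<phi> \<longleftrightarrow>
    eventually (\<lambda>i. sat (M i) (\<lambda>v. rep (e v) i) (map_fm (\<lambda>b. rep b i) \<phi>)) D"
  using assms
proof (induction \<phi> arbitrary: e)
  case Fls
  then show ?case using D_nontrivial by simp
next
  case (Eq s t)
  have s: "wf_tm L s" "params_tm s \<subseteq> univ U" "\<And>v. v \<in> fv_tm s \<Longrightarrow> e v \<in> univ U"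
    and t: "wf_tm L t" "params_tm t \<subseteq> univ U" "\<And>v. v \<in> fv_tm t \<Longrightarrow> e v \<in> univ U"
    using Eq.prems by auto
  have "sat U e (Eq s t) \<longleftrightarrow> eventually (\<lambda>i. rep (eval_tm U e s) i = rep (eval_tm U e t) i) D"
    using eq_iff_rep[OF eval_in_univ[OF is_struct_U s] eval_in_univ[OF is_struct_U t]] by simp
  also have "\<dots> \<longleftrightarrow> eventually (\<lambda>i. sat (M i) (\<lambda>v. rep (e v) i) (map_fm (\<lambda>b. rep b i) (Eq s t))) D"
  proof (rule eventually_cong[OF eventually_conj[OF los_tm[OF s] los_tm[OF t]]])
    fix i assume "rep (eval_tm U e s) i = eval_tm (M i) (\<lambda>v. rep (e v) i) (map_tm (\<lambda>b. rep b i) s) \<and>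
      rep (eval_tm U e t) i = eval_tm (M i) (\<lambda>v. rep (e v) i) (map_tm (\<lambda>b. rep b i) t)"
    then show "rep (eval_tm U e s) i = rep (eval_tm U e t) i \<longleftrightarrow>
        sat (M i) (\<lambda>v. rep (e v) i) (map_fm (\<lambda>b. rep b i) (Eq s t))"
      by simp
  qed
  finally show ?case .
next
  case (Rel r ts)
  have ts: "wf_tm L t" "params_tm t \<subseteq> univ U" "\<And>v. v \<in> fv_tm t \<Longrightarrow> e v \<in> univ U" if "t \<in> set ts" for t
    using Rel.prems that by auto
  have ev: "eventually (\<lambda>i. \<forall>t\<in>set ts. rep (eval_tm U e t) i =
      eval_tm (M i) (\<lambda>v. rep (e v) i) (map_tm (\<lambda>b. rep b i) t)) D"
    using los_tm ts by (intro eventually_ball_finite) auto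
  have "sat U e (Rel r ts) \<longleftrightarrow>
      eventually (\<lambda>i. rinterp (M i) r (map (\<lambda>b. rep b i) (map (eval_tm U e) ts))) D"
    by (simp add: ultraproduct_def)
  also have "\<dots> \<longleftrightarrow> eventually (\<lambda>i. sat (M i) (\<lambda>v. rep (e v) i) (map_fm (\<lambda>b. rep b i) (Rel r ts))) D"
  proof (rule eventually_cong[OF ev])
    fix i assume *: "\<forall>t\<in>set ts. rep (eval_tm U e t) i =
      eval_tm (M i) (\<lambda>v. rep (e v) i) (map_tm (\<lambda>b. rep b i) t)"
    have "map (\<lambda>b. rep b i) (map (eval_tm U e) ts) =
        map (eval_tm (M i) (\<lambda>v. rep (e v) i)) (map (map_tm (\<lambda>b. rep b i)) ts)"
      using * by simp
    then show "rinterp (M i) r (map (\<lambda>b. rep b i) (map (eval_tm U e) ts)) \<longleftrightarrow>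
        sat (M i) (\<lambda>v. rep (e v) i) (map_fm (\<lambda>b. rep b i) (Rel r ts))"
      by (simp only: fm.map sat.simps)
  qed
  finally show ?case .
next
  case (Neg \<phi>)
  have "sat U e \<phi> \<longleftrightarrow> eventually (\<lambda>i. sat (M i) (\<lambda>v. rep (e v) i) (map_fm (\<lambda>b. rep b i) \<phi>)) D"
    by (rule Neg.IH) (use Neg.prems in auto)
  then show ?case by (simp add: ultrafilter_not[OF D])
next
  case (Or \<phi> \<psi>)
  have "sat U e \<phi> \<longleftrightarrow> eventually (\<lambda>i. sat (M i) (\<lambda>v. rep (e v) i) (map_fm (\<lambda>b. rep b i) \<phi>)) D"
    by (rule Or.IH(1)) (use Or.prems in auto)
  moreover have "sat U e \<psi> \<longleftrightarrow> eventually (\<lambda>i. sat (M i) (\<lambda>v. rep (e v) i) (map_fm (\<lambda>b. rep b i) \<psi>)) D"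
    by (rule Or.IH(2)) (use Or.prems in auto)
  ultimately show ?case by (simp add: ultrafilter_or[OF D])
next
  case (Ex v \<phi>)
  let ?sat = "\<lambda>i x. sat (M i) ((\<lambda>w. rep (e w) i)(v := x)) (map_fm (\<lambda>b. rep b i) \<phi>)"
  have IH: "sat U (e(v := a)) \<phi> \<longleftrightarrow> eventually (\<lambda>i. ?sat i (rep a i)) D" if "a \<in> univ U" for a
  proof -
    have "sat U (e(v := a)) \<phi> \<longleftrightarrow>
        eventually (\<lambda>i. sat (M i) (\<lambda>w. rep ((e(v := a)) w) i) (map_fm (\<lambda>b. rep b i) \<phi>)) D"
      by (rule Ex.IH) (use Ex.prems that in auto)
    moreover have "(\<lambda>w. rep ((e(v := a)) w) i) = (\<lambda>w. rep (e w) i)(v := rep a i)" for i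
      by auto
    ultimately show ?thesis by simp
  qed
  have "(\<exists>a\<in>univ U. eventually (\<lambda>i. ?sat i (rep a i)) D) \<longleftrightarrow>
      eventually (\<lambda>i. \<exists>x\<in>univ (M i). ?sat i x) D"
  proof
    assume "\<exists>a\<in>univ U. eventually (\<lambda>i. ?sat i (rep a i)) D"
    then obtain a where a: "a \<in> univ U" "eventually (\<lambda>i. ?sat i (rep a i)) D" by blast
    show "eventually (\<lambda>i. \<exists>x\<in>univ (M i). ?sat i x) D"
      using a(2) by eventually_elim (use rep_univ[OF a(1)] in blast)
  next
    assume ev: "eventually (\<lambda>i. \<exists>x\<in>univ (M i). ?sat i x) D"
    have "\<exists>x. x \<in> univ (M i) \<and> ((\<exists>x\<in>univ (M i). ?sat i x) \<longrightarrow> ?sat i x)" for i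
      using struct[of i] unfolding is_struct_def by blast
    then obtain f where f: "\<And>i. f i \<in> univ (M i)" "\<And>i. (\<exists>x\<in>univ (M i). ?sat i x) \<Longrightarrow> ?sat i (f i)"
      by metis
    have "eventually (\<lambda>i. ?sat i (rep (cls f) i)) D"
      using ev rep_cls[OF f(1)] by eventually_elim (use f(2) in simp)
    then show "\<exists>a\<in>univ U. eventually (\<lambda>i. ?sat i (rep a i)) D" using cls_univ[OF f(1)] by blast
  qed
  then show ?case using IH by simp
qed

lemma map_rep_forms:
  "\<phi> \<in> forms L U X \<Longrightarrow> map_fm (\<lambda>b. rep b i) \<phi> \<in> forms L (M i) X"
  using rep_univ by (auto simp: forms_def wf_map fv_map fm.set_map)

end

section \<open>Double averages of pseudo-finite measures\<close>

text \<open>A convex combination of Dirac measures at tuples, in terms of satisfaction.\<close>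

definition point_masses ::
  "('f, 'r) lang \<Rightarrow> ('f, 'r, 'a) struct \<Rightarrow> nat set \<Rightarrow> (('f, 'r, 'a) fm \<Rightarrow> real) \<Rightarrow>
    nat \<Rightarrow> (nat \<Rightarrow> real) \<Rightarrow> (nat \<Rightarrow> nat \<Rightarrow> 'a) \<Rightarrow> bool" where
  "point_masses L N X \<mu> n r a \<longleftrightarrow>
    (\<forall>k<n. a k \<in> tuples N X) \<and> (\<forall>k<n. 0 < r k) \<and> (\<Sum>k<n. r k) = 1 \<and>
    (\<forall>\<phi>\<in>forms L N X. \<mu> \<phi> = (\<Sum>k<n. r k * of_bool (sat N (a k) \<phi>)))"

lemma point_masses_tuples: "point_masses L N X \<mu> n r a \<Longrightarrow> k < n \<Longrightarrow> a k \<in> tuples N X"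
  and point_masses_pos: "point_masses L N X \<mu> n r a \<Longrightarrow> k < n \<Longrightarrow> 0 < r k"
  and point_masses_total: "point_masses L N X \<mu> n r a \<Longrightarrow> (\<Sum>k<n. r k) = 1"
  and point_masses_eval: "point_masses L N X \<mu> n r a \<Longrightarrow> \<phi> \<in> forms L N X \<Longrightarrow>
    \<mu> \<phi> = (\<Sum>k<n. r k * of_bool (sat N (a k) \<phi>))"
  by (simp_all add: point_masses_def)

lemma conv_meas_point_masses:
  assumes "\<mu> \<in> conv_meas L N X"
  shows "\<exists>n r a. point_masses L N X \<mu> n r a"
proof -
  obtain n :: nat and r a where *: "\<mu> = (\<lambda>\<phi>\<in>forms L N X. \<Sum>i<n. r i * dirac L N X (tp L N X (a i)) \<phi>)"
    "\<forall>i<n. a i \<in> tuples N X" "\<forall>i<n. r i > 0" "(\<Sum>i<n. r i) = 1"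
    using assms unfolding conv_meas_def by blast
  have "\<mu> \<phi> = (\<Sum>k<n. r k * of_bool (sat N (a k) \<phi>))" if "\<phi> \<in> forms L N X" for \<phi>
    unfolding *(1) using that by (simp add: dirac_def in_tp of_bool_def)
  then have "point_masses L N X \<mu> n r a" using *(2-4) by (simp add: point_masses_def)
  then show ?thesis by (intro exI)
qed

lemma weighted_sum_close:
  fixes s :: "nat \<Rightarrow> real"
  assumes "\<And>l. l < m \<Longrightarrow> 0 < s l" "(\<Sum>l<m. s l) = 1" "\<And>l. l < m \<Longrightarrow> \<bar>f l - g l\<bar> \<le> \<epsilon>"
  shows "\<bar>(\<Sum>l<m. s l * f l) - (\<Sum>l<m. s l * g l)\<bar> \<le> \<epsilon>"
proof -
  have "\<bar>(\<Sum>l<m. s l * f l) - (\<Sum>l<m. s l * g l)\<bar> = \<bar>\<Sum>l<m. s l * (f l - g l)\<bar>"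
    by (simp add: sum_subtractf right_diff_distrib)
  also have "\<dots> \<le> (\<Sum>l<m. \<bar>s l * (f l - g l)\<bar>)" by (rule sum_abs)
  also have "\<dots> \<le> (\<Sum>l<m. s l * \<epsilon>)"
    using assms(1,3) by (intro sum_mono) (simp add: abs_mult abs_of_pos)
  also have "\<dots> = \<epsilon>" using assms(2) by (simp flip: sum_distrib_right)
  finally show ?thesis .
qed

context ultraproduct_structs
begin

abbreviation component :: "'i \<Rightarrow> ('f, 'r, ('i \<Rightarrow> 'a) set) fm \<Rightarrow> ('f, 'r, 'a) fm" where
  "component i \<phi> \<equiv> map_fm (\<lambda>b. rep b i) \<phi>"

text \<open>Probability measures have values in a bounded interval, so that the limit along the
  ultrafilter exists.\<close>

lemma ultralimit_tendsto:
  assumes w: "\<And>i. point_masses L (M i) X (\<mu>s i) (n i) (r i) (a i)" and \<phi>: "\<phi> \<in> forms L U X"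
  shows "((\<lambda>i. \<mu>s i (component i \<phi>)) \<longlongrightarrow> ultralimit L D M X \<mu>s \<phi>) D"
proof -
  have "\<bar>\<mu>s i (component i \<phi>)\<bar> \<le> 1" for i
  proof -
    note pos = point_masses_pos[OF w] and val = point_masses_eval[OF w map_rep_forms[OF \<phi>]]
    have "0 \<le> \<mu>s i (component i \<phi>)"
      unfolding val using pos by (intro sum_nonneg) (simp add: less_imp_le)
    moreover have "\<mu>s i (component i \<phi>) \<le> (\<Sum>k<n i. r i k)"
      unfolding val using pos by (intro sum_mono) (simp add: less_imp_le)
    ultimately show ?thesis using point_masses_total[OF w, of i] by simp
  qed
  then have "((\<lambda>i. \<mu>s i (component i \<phi>)) \<longlongrightarrow> Lim D (\<lambda>i. \<mu>s i (component i \<phi>))) D"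
    by (rule ultrafilter_bounded_tendsto_Lim[OF D])
  then show ?thesis using \<phi> by (simp add: ultralimit_def)
qed

text \<open>The form of saturation used here: arbitrary choices of tuples in the factors come from the
  ultraproduct.\<close>

lemma tuple_lift:
  assumes fin: "finite Y" and B: "\<And>i. B i \<in> tuples (M i) Y"
  obtains b where "b \<in> tuples U Y" "eventually (\<lambda>i. \<forall>v\<in>Y. rep (b v) i = B i v) D"
proof
  have Bu: "B i v \<in> univ (M i)" if "v \<in> Y" for i v
    using B[of i] that by (auto simp: tuples_def)
  let ?b = "\<lambda>v\<in>Y. cls (\<lambda>i. B i v)"
  show "?b \<in> tuples U Y" using Bu cls_univ by (auto simp: tuples_def)
  have "eventually (\<lambda>i. rep (?b v) i = B i v) D" if "v \<in> Y" for v
    using rep_cls[of "\<lambda>i. B i v"] Bu that by simp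
  then show "eventually (\<lambda>i. \<forall>v\<in>Y. rep (?b v) i = B i v) D"
    using fin by (intro eventually_ball_finite) auto
qed

text \<open>An approximation valid at all tuples of the ultraproduct is valid, with a slightly larger
  error, at all tuples of almost all factors.  If it failed at tuples \<open>B i\<close> for almost all \<open>i\<close>, then it
  would fail at the tuple that they represent: by the definition of \<open>\<mu>\<close> as an ultralimit and by the theorem of
  Los, both sides of the estimate at that tuple are the limits of those at \<open>B i\<close>.\<close>

lemma fiber_approximation_transfers:
  assumes fin: "finite Y" and w: "\<And>i. point_masses L (M i) X (\<mu>s i) (n i) (r i) (a i)"
    and \<mu>: "\<mu> = ultralimit L D M X \<mu>s" and \<phi>: "\<phi> \<in> forms L U (X \<union> Y)"
    and J: "finite J" "\<And>j. j \<in> J \<Longrightarrow> \<theta> j \<in> forms L U Y"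
    and approx: "\<And>b. b \<in> tuples U Y \<Longrightarrow>
      \<bar>\<mu> (inst Y b \<phi>) - (\<Sum>j\<in>J. c j * of_bool (sat U b (\<theta> j)))\<bar> \<le> \<epsilon>"
    and \<epsilon>: "\<epsilon> < \<delta>"
  shows "eventually (\<lambda>i. \<forall>b\<in>tuples (M i) Y.
    \<bar>\<mu>s i (inst Y b (component i \<phi>)) - (\<Sum>j\<in>J. c j * of_bool (sat (M i) b (component i (\<theta> j))))\<bar> \<le> \<delta>) D"
    (is "eventually (\<lambda>i. \<forall>b\<in>tuples (M i) Y. \<bar>?\<mu> i b - ?G i b\<bar> \<le> \<delta>) D")
proof (rule ccontr)
  \<comment> \<open>A tuple is chosen in every factor, a bad one wherever there is one.\<close>
  define bad where "bad i b \<longleftrightarrow> b \<in> tuples (M i) Y \<and> \<not> \<bar>?\<mu> i b - ?G i b\<bar> \<le> \<delta>" for i b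
  assume "\<not> ?thesis"
  then have "eventually (\<lambda>i. \<not> (\<forall>b\<in>tuples (M i) Y. \<bar>?\<mu> i b - ?G i b\<bar> \<le> \<delta>)) D"
    using ultrafilter_not[OF D] by blast
  then have ev_bad: "eventually (\<lambda>i. \<exists>b. bad i b) D"
    unfolding bad_def by eventually_elim blast
  have "\<exists>b. b \<in> tuples (M i) Y \<and> ((\<exists>b. bad i b) \<longrightarrow> bad i b)" for i
  proof (cases "\<exists>b. bad i b")
    case True
    then show ?thesis unfolding bad_def by blast
  next
    case False
    obtain x where "x \<in> univ (M i)" using struct[of i] unfolding is_struct_def by blast
    then have "(\<lambda>v\<in>Y. x) \<in> tuples (M i) Y" by (simp add: tuples_def)
    then show ?thesis using False by blast
  qed
  then obtain B where B: "\<And>i. B i \<in> tuples (M i) Y" "\<And>i. (\<exists>b. bad i b) \<Longrightarrow> bad i (B i)"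
    by metis
  obtain b where b: "b \<in> tuples U Y" and bB: "eventually (\<lambda>i. \<forall>v\<in>Y. rep (b v) i = B i v) D"
    using tuple_lift[OF fin B(1)] .
  have "((\<lambda>i. \<mu>s i (component i (inst Y b \<phi>))) \<longlongrightarrow> \<mu> (inst Y b \<phi>)) D"
    unfolding \<mu> using w inst_forms[OF \<phi> order_refl b] by (rule ultralimit_tendsto)
  moreover have "eventually (\<lambda>i. \<mu>s i (component i (inst Y b \<phi>)) = ?\<mu> i (B i)) D"
    using bB by eventually_elim (auto simp: map_inst intro!: arg_cong[where f = "\<mu>s _"] inst_cong)
  ultimately have lim_\<mu>: "((\<lambda>i. ?\<mu> i (B i)) \<longlongrightarrow> \<mu> (inst Y b \<phi>)) D"
    by (rule Lim_transform_eventually)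
  have los_B: "eventually (\<lambda>i. sat (M i) (B i) (component i (\<theta> j)) \<longleftrightarrow> sat U b (\<theta> j)) D" if "j \<in> J" for j
  proof -
    let ?sat = "\<lambda>i. sat (M i) (\<lambda>v. rep (b v) i) (component i (\<theta> j))"
    have fv: "fv (\<theta> j) \<subseteq> Y" and wf: "wf_fm L (\<theta> j)" "params (\<theta> j) \<subseteq> univ U"
      using J(2)[OF that] by (simp_all add: forms_def)
    have "sat U b (\<theta> j) \<longleftrightarrow> eventually ?sat D"
      by (rule los[OF wf]) (use fv b in \<open>auto simp: tuples_def\<close>)
    then have "eventually (\<lambda>i. ?sat i \<longleftrightarrow> sat U b (\<theta> j)) D"
      using ultrafilter_not[OF D, of ?sat] by (cases "sat U b (\<theta> j)") simp_all
    with bB show ?thesis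
    proof eventually_elim
      case (elim i)
      have "sat (M i) (B i) (component i (\<theta> j)) \<longleftrightarrow> ?sat i"
        by (rule sat_cong) (use fv elim(1) in \<open>auto simp: fv_map\<close>)
      then show ?case using elim(2) by simp
    qed
  qed
  then have "eventually (\<lambda>i. \<forall>j\<in>J. sat (M i) (B i) (component i (\<theta> j)) \<longleftrightarrow> sat U b (\<theta> j)) D"
    using J(1) by (intro eventually_ball_finite) auto
  then have "eventually (\<lambda>i. (\<Sum>j\<in>J. c j * of_bool (sat U b (\<theta> j))) = ?G i (B i)) D"
    by eventually_elim simp
  then have lim_G: "((\<lambda>i. ?G i (B i)) \<longlongrightarrow> (\<Sum>j\<in>J. c j * of_bool (sat U b (\<theta> j)))) D"
    by (rule Lim_transform_eventually[OF tendsto_const])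
  have "\<delta> \<le> \<bar>\<mu> (inst Y b \<phi>) - (\<Sum>j\<in>J. c j * of_bool (sat U b (\<theta> j)))\<bar>"
  proof (rule tendsto_lowerbound[OF tendsto_rabs[OF tendsto_diff[OF lim_\<mu> lim_G]] _ D_nontrivial])
    show "eventually (\<lambda>i. \<delta> \<le> \<bar>?\<mu> i (B i) - ?G i (B i)\<bar>) D"
      using ev_bad
    proof eventually_elim
      case (elim i)
      then have "bad i (B i)" by (rule B(2))
      then show ?case unfolding bad_def by linarith
    qed
  qed
  then show False using approx[OF b] \<epsilon> by simp
qed

text \<open>The value on \<open>\<phi>(x,y)\<close> of the product of the finitely supported measures in the factor
  \<open>M i\<close>, as an iterated sum.\<close>

definition product_average ::
  "nat set \<Rightarrow> ('i \<Rightarrow> nat) \<Rightarrow> ('i \<Rightarrow> nat \<Rightarrow> real) \<Rightarrow> ('i \<Rightarrow> nat \<Rightarrow> nat \<Rightarrow> 'a) \<Rightarrow>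
    ('i \<Rightarrow> nat) \<Rightarrow> ('i \<Rightarrow> nat \<Rightarrow> real) \<Rightarrow> ('i \<Rightarrow> nat \<Rightarrow> nat \<Rightarrow> 'a) \<Rightarrow>
    ('f, 'r, ('i \<Rightarrow> 'a) set) fm \<Rightarrow> 'i \<Rightarrow> real" where
  "product_average Y n r a m s b \<phi> i =
    (\<Sum>l<m i. s i l * (\<Sum>k<n i. r i k * of_bool (sat (M i) (override_on (a i k) (b i l) Y) (component i \<phi>))))"

theorem product_average_tendsto_morley:
  assumes fin: "finite X" "finite Y" and disj: "X \<inter> Y = {}"
    and \<nu>: "\<nu> \<in> keisler L U Y" and def: "definable L U X \<mu>"
    and \<mu>_lim: "\<mu> = ultralimit L D M X \<mu>s" and w: "\<And>i. point_masses L (M i) X (\<mu>s i) (n i) (r i) (a i)"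
    and \<nu>_lim: "\<nu> = ultralimit L D M Y \<nu>s" and w': "\<And>i. point_masses L (M i) Y (\<nu>s i) (m i) (s i) (b i)"
    and \<phi>: "\<phi> \<in> forms L U (X \<union> Y)"
  shows "(product_average Y n r a m s b \<phi> \<longlongrightarrow> morley L U X Y \<mu> \<nu> \<phi>) D"
proof (rule tendstoI)
  fix \<epsilon> :: real assume "0 < \<epsilon>"
  \<comment> \<open>Room for \<open>2 \<delta>\<close> from the factors and \<open>\<delta>\<close> each from the limit and the integral.\<close>
  define \<delta> where "\<delta> = \<epsilon> / 5"
  have \<delta>: "0 < \<delta>" "\<delta> < 2 * \<delta>" "5 * \<delta> = \<epsilon>" using \<open>0 < \<epsilon>\<close> by (simp_all add: \<delta>_def)
  define F where "F = fiber_map L U Y \<mu> \<phi>"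
  define I where "I = (\<integral>p. F p \<partial>borel_extension L U Y \<nu>)"
  have morley: "morley L U X Y \<mu> \<nu> \<phi> = I" using \<phi> by (simp add: morley_def I_def F_def)
  have F: "is_fiber_map L U Y \<mu> \<phi> F"
    unfolding F_def by (rule definable_fiber_map[OF def fin disj \<phi>])
  obtain J :: "('f, 'r, ('i \<Rightarrow> 'a) set) fm set" and c \<theta> where J: "finite J" "\<And>j. j \<in> J \<Longrightarrow> \<theta> j \<in> forms L U Y"
    and step: "\<And>p. p \<in> types L U Y \<Longrightarrow> \<bar>F p - (\<Sum>j\<in>J. c j * of_bool (\<theta> j \<in> p))\<bar> \<le> \<delta>"
    by (rule step_approximation[OF fiber_map_continuous[OF F] \<delta>(1)]) (rule that)
  have integral: "\<bar>I - (\<Sum>j\<in>J. c j * \<nu> (\<theta> j))\<bar> \<le> \<delta>"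
    unfolding I_def by (rule integral_step_approximation[OF \<nu> fiber_map_continuous[OF F] J step])
  have fibers: "\<bar>\<mu> (inst Y b \<phi>) - (\<Sum>j\<in>J. c j * of_bool (sat U b (\<theta> j)))\<bar> \<le> \<delta>"
    if b: "b \<in> tuples U Y" for b
  proof -
    have "F (tp L U Y b) = \<mu> (inst Y b \<phi>)" using F b unfolding is_fiber_map_def by blast
    moreover have "(\<Sum>j\<in>J. c j * of_bool (\<theta> j \<in> tp L U Y b)) = (\<Sum>j\<in>J. c j * of_bool (sat U b (\<theta> j)))"
      using J(2) by (intro sum.cong) (simp_all add: in_tp)
    ultimately show ?thesis using step[OF tp_types[OF b]] by simp
  qed
  have uniform: "eventually (\<lambda>i. \<forall>b\<in>tuples (M i) Y. \<bar>\<mu>s i (inst Y b (component i \<phi>)) -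
      (\<Sum>j\<in>J. c j * of_bool (sat (M i) b (component i (\<theta> j))))\<bar> \<le> 2 * \<delta>) D"
    by (rule fiber_approximation_transfers[OF fin(2) w \<mu>_lim \<phi> J fibers \<delta>(2)])
  have "((\<lambda>i. \<Sum>j\<in>J. c j * \<nu>s i (component i (\<theta> j))) \<longlongrightarrow> (\<Sum>j\<in>J. c j * \<nu> (\<theta> j))) D"
    unfolding \<nu>_lim using J(2) by (intro tendsto_sum tendsto_mult tendsto_const ultralimit_tendsto[OF w'])
  then have "eventually (\<lambda>i. dist (\<Sum>j\<in>J. c j * \<nu>s i (component i (\<theta> j))) (\<Sum>j\<in>J. c j * \<nu> (\<theta> j)) < \<delta>) D"
    using \<delta>(1) by (rule tendstoD)
  with uniform show "eventually (\<lambda>i. dist (product_average Y n r a m s b \<phi> i) (morley L U X Y \<mu> \<nu> \<phi>) < \<epsilon>) D"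
  proof eventually_elim
    case (elim i)
    let ?G = "\<lambda>b. \<Sum>j\<in>J. c j * of_bool (sat (M i) b (component i (\<theta> j)))"
    note pts = point_masses_tuples[OF w'] point_masses_pos[OF w']
    have fiber: "\<mu>s i (inst Y (b i l) (component i \<phi>)) =
        (\<Sum>k<n i. r i k * of_bool (sat (M i) (override_on (a i k) (b i l) Y) (component i \<phi>)))" if "l < m i" for l
    proof -
      have "inst Y (b i l) (component i \<phi>) \<in> forms L (M i) X"
        by (rule inst_forms[OF map_rep_forms[OF \<phi>] order_refl pts(1)[OF that]])
      from point_masses_eval[OF w this] show ?thesis by (simp only: sat_inst)
    qed
    have "product_average Y n r a m s b \<phi> i = (\<Sum>l<m i. s i l * \<mu>s i (inst Y (b i l) (component i \<phi>)))"
      unfolding product_average_def by (intro sum.cong) (simp_all add: fiber)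
    moreover have "\<bar>(\<Sum>l<m i. s i l * \<mu>s i (inst Y (b i l) (component i \<phi>))) - (\<Sum>l<m i. s i l * ?G (b i l))\<bar> \<le> 2 * \<delta>"
    proof (rule weighted_sum_close)
      show "(\<Sum>l<m i. s i l) = 1" by (rule point_masses_total[OF w'])
    qed (use pts elim(1) in auto)
    moreover have "(\<Sum>l<m i. s i l * ?G (b i l)) = (\<Sum>j\<in>J. c j * \<nu>s i (component i (\<theta> j)))"
    proof -
      have "\<nu>s i (component i (\<theta> j)) = (\<Sum>l<m i. s i l * of_bool (sat (M i) (b i l) (component i (\<theta> j))))"
        if "j \<in> J" for j
        by (rule point_masses_eval[OF w' map_rep_forms[OF J(2)[OF that]]])
      then have "(\<Sum>j\<in>J. c j * \<nu>s i (component i (\<theta> j))) =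
          (\<Sum>j\<in>J. \<Sum>l<m i. s i l * (c j * of_bool (sat (M i) (b i l) (component i (\<theta> j)))))"
        by (intro sum.cong refl) (simp only: sum_distrib_left mult.left_commute)
      also have "\<dots> = (\<Sum>l<m i. s i l * ?G (b i l))"
        by (subst sum.swap) (simp only: sum_distrib_left)
      finally show ?thesis by simp
    qed
    ultimately show ?case
      using elim(2) integral \<delta> unfolding morley dist_real_def by linarith
  qed
qed

text \<open>Fubini for finite sums.\<close>

lemma product_average_commute:
  assumes disj: "X \<inter> Y = {}" and \<phi>: "\<phi> \<in> forms L U (X \<union> Y)"
  shows "product_average Y n r a m s b \<phi> = product_average X m s b n r a \<phi>"
proof
  fix i
  have "sat (M i) (override_on (a i k) (b i l) Y) (component i \<phi>) \<longleftrightarrow>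
      sat (M i) (override_on (b i l) (a i k) X) (component i \<phi>)" for k l
    by (rule sat_cong) (use \<phi> disj in \<open>auto simp: forms_def fv_map override_on_def\<close>)
  then have "product_average Y n r a m s b \<phi> i =
      (\<Sum>l<m i. \<Sum>k<n i. s i l * (r i k * of_bool (sat (M i) (override_on (b i l) (a i k) X) (component i \<phi>))))"
    by (simp only: product_average_def sum_distrib_left)
  also have "\<dots> = (\<Sum>k<n i. \<Sum>l<m i. r i k * (s i l * of_bool (sat (M i) (override_on (b i l) (a i k) X) (component i \<phi>))))"
    by (subst sum.swap) (simp only: mult.left_commute)
  also have "\<dots> = product_average X m s b n r a \<phi> i"
    by (simp only: product_average_def sum_distrib_left)
  finally show "product_average Y n r a m s b \<phi> i = product_average X m s b n r a \<phi> i" .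
qed

end

theorem corollary4p9:
  fixes L :: "('f, 'r) lang"
    and M :: "'i \<Rightarrow> ('f, 'r, 'a) struct"
    and D :: "'i filter"
    and X Y :: "nat set"
    and \<mu> \<nu> :: "('f, 'r, ('i \<Rightarrow> 'a) set) fm \<Rightarrow> real"
  assumes "infinite (UNIV :: 'i set)"
    and "ultrafilter D" and "nonprincipal D"
    and "\<And>i. is_struct L (M i)"
    and "finite X" and "finite Y" and "X \<inter> Y = {}"
    and "\<mu> \<in> keisler L (ultraproduct D M) X"
    and "\<nu> \<in> keisler L (ultraproduct D M) Y"
    and "pseudofinite L D M X \<mu>"
    and "pseudofinite L D M Y \<nu>"
    and "definable L (ultraproduct D M) X \<mu>"
    and "definable L (ultraproduct D M) Y \<nu>"
  shows "morley L (ultraproduct D M) X Y \<mu> \<nu> = morley L (ultraproduct D M) Y X \<nu> \<mu>"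
proof -
  interpret ultraproduct_structs L M D
    using assms(2,4) by unfold_locales
  obtain \<mu>s where \<mu>s: "\<And>i. \<mu>s i \<in> conv_meas L (M i) X" "\<mu> = ultralimit L D M X \<mu>s"
    using assms(10) unfolding pseudofinite_def by blast
  obtain \<nu>s where \<nu>s: "\<And>i. \<nu>s i \<in> conv_meas L (M i) Y" "\<nu> = ultralimit L D M Y \<nu>s"
    using assms(11) unfolding pseudofinite_def by blast
  have "\<forall>i. \<exists>n r a. point_masses L (M i) X (\<mu>s i) n r a"
    using conv_meas_point_masses[OF \<mu>s(1)] by blast
  then obtain n r a where w: "\<And>i. point_masses L (M i) X (\<mu>s i) (n i) (r i) (a i)" by metis
  have "\<forall>i. \<exists>m s b. point_masses L (M i) Y (\<nu>s i) m s b"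
    using conv_meas_point_masses[OF \<nu>s(1)] by blast
  then obtain m s b where w': "\<And>i. point_masses L (M i) Y (\<nu>s i) (m i) (s i) (b i)" by metis
  show ?thesis
  proof (rule extensionalityI)
    show "morley L U X Y \<mu> \<nu> \<in> extensional (forms L U (X \<union> Y))"
      by (simp add: morley_def)
    show "morley L U Y X \<nu> \<mu> \<in> extensional (forms L U (X \<union> Y))"
      by (simp add: morley_def Un_commute)
    fix \<phi> assume \<phi>: "\<phi> \<in> forms L U (X \<union> Y)"
    then have \<phi>': "\<phi> \<in> forms L U (Y \<union> X)" by (simp add: Un_commute)
    have disj': "Y \<inter> X = {}" using assms(7) by blast
    have "(product_average Y n r a m s b \<phi> \<longlongrightarrow> morley L U X Y \<mu> \<nu> \<phi>) D"
      by (rule product_average_tendsto_morley[OF assms(5,6,7,9,12) \<mu>s(2) w \<nu>s(2) w' \<phi>])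
    moreover have "(product_average Y n r a m s b \<phi> \<longlongrightarrow> morley L U Y X \<nu> \<mu> \<phi>) D"
      unfolding product_average_commute[OF assms(7) \<phi>]
      by (rule product_average_tendsto_morley[OF assms(6,5) disj' assms(8,13) \<nu>s(2) w' \<mu>s(2) w \<phi>'])
    ultimately show "morley L U X Y \<mu> \<nu> \<phi> = morley L U Y X \<nu> \<mu> \<phi>"
      by (rule tendsto_unique[OF D_nontrivial])
  qed
qed

end
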